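(* For any $d\ge 1$, for all norms $\|\cdot\|$ on $\mathbb{R}^d$ besides a meagre set, the odd distance graph of $\|\cdot\|$ has chromatic number at most $2^d$.
   Context: The odd distance graph of a norm $\|\cdot\|$ on $\mathbb{R}^d$ is the graph whose vertices are the points of $\mathbb{R}^d$, where two points are adjacent if and only if the distance between them according to $\|\cdot\|$ is an odd integer. Let $\mathcal{B}_d$ be the set of all closed, bounded, $\mathbf{0}$-symmetric convex bodies in $\mathbb{R}^d$ containing $\mathbf{0}$ in the interior. The map sending a norm $\|\cdot\|$ to its unit ball $\{\mathbf{x}\in\mathbb{R}^d: \|\mathbf{x}\|\le 1\}$ is a bijection between norms on $\mathbb{R}^d$ and $\mathcal{B}_d$. The set $\mathcal{B}_d$ is endowed with the Hausdorff metric $d_H(A,B)=\max\{\sup_{\mathbf{a}\in A}\inf_{\mathbf{b}\in B}\|\mathbf{a}-\mathbf{b}\|_2,\ \sup_{\mathbf{b}\in B}\inf_{\mathbf{a}\in A}\|\mathbf{a}-\mathbf{b}\|_2\}$, where $\|\cdot\|_2$ is the Euclidean norm. A set in a metric space is nowhere dense if every non-empty open set contains a non-empty open subset disjoint from it; a meagre set is a countable union of nowhere dense sets. A property holds for all norms on $\mathbb{R}^d$ besides a meagre set if the set of unit balls of the norms failing the property is a meagre set in $(\mathcal{B}_d,d_H)$. *)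

theory Defs
  imports "HOL-Analysis.Analysis"
begin

section \<open>Norms and their unit balls\<close>

definition is_norm :: "('a::real_vector \<Rightarrow> real) \<Rightarrow> bool" where
  "is_norm N \<longleftrightarrow>
     (\<forall>x. 0 \<le> N x) \<and> (\<forall>x. N x = 0 \<longleftrightarrow> x = 0) \<and>
     (\<forall>c x. N (c *\<^sub>R x) = \<bar>c\<bar> * N x) \<and> (\<forall>x y. N (x + y) \<le> N x + N y)"

definition unit_ball :: "('a \<Rightarrow> real) \<Rightarrow> 'a set" where
  "unit_ball N = {x. N x \<le> 1}"

definition sym_bodies :: "(real ^ 'n) set set" where
  "sym_bodies =
     {K. closed K \<and> bounded K \<and> convex K \<and> (\<forall>x\<in>K. - x \<in> K) \<and> 0 \<in> interior K}"


section \<open>The Hausdorff metric\<close>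

text \<open>
  Real suprema and infima are unspecified for empty or unbounded sets. The value 0 is used
  there, because the locale \<^locale>\<open>Metric_space\<close> requires nonnegativity on the whole type;
  no such set belongs to \<^const>\<open>sym_bodies\<close>.
\<close>

definition hausdorff_dist :: "'a::real_normed_vector set \<Rightarrow> 'a set \<Rightarrow> real" where
  "hausdorff_dist A B =
     (if A \<noteq> {} \<and> bounded A \<and> B \<noteq> {} \<and> bounded B
      then max (SUP a\<in>A. INF b\<in>B. norm (a - b)) (SUP b\<in>B. INF a\<in>A. norm (a - b))
      else 0)"

definition sym_body_topology :: "(real ^ 'n) set topology" where
  "sym_body_topology = Metric_space.mtopology sym_bodies hausdorff_dist"


section \<open>Meagre sets\<close>

definition nowhere_dense_in :: "'a topology \<Rightarrow> 'a set \<Rightarrow> bool" where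
  "nowhere_dense_in X S \<longleftrightarrow> S \<subseteq> topspace X \<and>
     (\<forall>U. openin X U \<and> U \<noteq> {} \<longrightarrow> (\<exists>V. openin X V \<and> V \<noteq> {} \<and> V \<subseteq> U \<and> V \<inter> S = {}))"

definition meagre_in :: "'a topology \<Rightarrow> 'a set \<Rightarrow> bool" where
  "meagre_in X S \<longleftrightarrow> (\<exists>\<F>. countable \<F> \<and> (\<forall>T\<in>\<F>. nowhere_dense_in X T) \<and> S = \<Union>\<F>)"

definition all_norms_besides_meagre :: "((real ^ 'n \<Rightarrow> real) \<Rightarrow> bool) \<Rightarrow> bool" where
  "all_norms_besides_meagre P \<longleftrightarrow>
     meagre_in sym_body_topology {unit_ball N | N. is_norm N \<and> \<not> P N}"


section \<open>Odd distance graphs and the chromatic number\<close>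

text \<open>A graph is given by its vertex set and its adjacency relation.\<close>

definition odd_distance_adj :: "('a::real_vector \<Rightarrow> real) \<Rightarrow> 'a \<Rightarrow> 'a \<Rightarrow> bool" where
  "odd_distance_adj N x y \<longleftrightarrow> (\<exists>k::int. odd k \<and> N (x - y) = of_int k)"

definition proper_colouring :: "'a set \<Rightarrow> ('a \<Rightarrow> 'a \<Rightarrow> bool) \<Rightarrow> nat \<Rightarrow> ('a \<Rightarrow> nat) \<Rightarrow> bool" where
  "proper_colouring V E k c \<longleftrightarrow>
     (\<forall>x\<in>V. c x < k) \<and> (\<forall>x\<in>V. \<forall>y\<in>V. E x y \<longrightarrow> c x \<noteq> c y)"

text \<open>The infimum of the empty set is \<open>\<infinity>\<close>, for graphs without a finite proper colouring.\<close>

definition chromatic_number :: "'a set \<Rightarrow> ('a \<Rightarrow> 'a \<Rightarrow> bool) \<Rightarrow> enat" where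
  "chromatic_number V E = Inf {enat k | k. \<exists>c. proper_colouring V E k c}"


section \<open>Basic facts\<close>

lemma is_norm_minus:
  assumes "is_norm N"
  shows "N (- x) = N x"
proof -
  have "N ((-1) *\<^sub>R x) = \<bar>-1\<bar> * N x"
    using assms unfolding is_norm_def by blast
  then show ?thesis by simp
qed

lemma odd_distance_adj_sym:
  assumes "is_norm N" "odd_distance_adj N x y"
  shows "odd_distance_adj N y x"
  using assms is_norm_minus[OF assms(1), of "x - y"] by (simp add: odd_distance_adj_def)

lemma odd_distance_adj_irrefl:
  assumes "is_norm N"
  shows "\<not> odd_distance_adj N x x"
proof -
  have "N 0 = 0" using assms unfolding is_norm_def by blast
  then show ?thesis by (auto simp: odd_distance_adj_def)
qed

lemma chromatic_number_le_iff:
  "chromatic_number V E \<le> enat k \<longleftrightarrow> (\<exists>c. proper_colouring V E k c)"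
proof
  assume le: "chromatic_number V E \<le> enat k"
  define S where "S = {enat j | j. \<exists>c. proper_colouring V E j c}"
  have eq: "chromatic_number V E = Inf S"
    by (simp add: chromatic_number_def S_def)
  have "S \<noteq> {}"
    using le eq by (metis Inf_enat_def enat_ord_code(5))
  then have "Inf S \<in> S"
    unfolding Inf_enat_def by (metis (mono_tags) LeastI all_not_in_conv)
  then obtain j c where jc: "Inf S = enat j" "proper_colouring V E j c"
    by (auto simp: S_def)
  with le eq have "j \<le> k" by simp
  with jc(2) have "proper_colouring V E k c"
    by (auto simp: proper_colouring_def intro: less_le_trans)
  then show "\<exists>c. proper_colouring V E k c" by blast
next
  assume "\<exists>c. proper_colouring V E k c"
  then show "chromatic_number V E \<le> enat k"
    unfolding chromatic_number_def by (intro Inf_lower) blast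
qed

lemma hausdorff_dist_le_iff:
  assumes "A \<noteq> {}" "bounded A" "B \<noteq> {}" "bounded B"
  shows "hausdorff_dist A B \<le> r \<longleftrightarrow> (\<forall>a\<in>A. infdist a B \<le> r) \<and> (\<forall>b\<in>B. infdist b A \<le> r)"
proof -
  have bdd: "bdd_above ((\<lambda>x. infdist x T) ` S)" if ST: "bounded S" "T \<noteq> {}" for S T :: "'a set"
  proof -
    obtain t where t: "t \<in> T" using ST by blast
    obtain e where e: "\<And>x. x \<in> S \<Longrightarrow> dist t x \<le> e"
      using ST(1) bounded_any_center by metis
    have "infdist x T \<le> e" if "x \<in> S" for x
      using infdist_le[OF t, of x] e[OF that] by (simp add: dist_commute)
    then show ?thesis by (rule bdd_aboveI2)
  qed
  have "(INF b\<in>B. norm (a - b)) = infdist a B" for a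
    using assms by (simp add: infdist_def dist_norm)
  moreover have "(INF a\<in>A. norm (a - b)) = infdist b A" for b
    using assms by (simp add: infdist_def dist_norm norm_minus_commute[of b])
  ultimately have "hausdorff_dist A B = max (SUP a\<in>A. infdist a B) (SUP b\<in>B. infdist b A)"
    using assms by (simp add: hausdorff_dist_def)
  then show ?thesis
    using assms bdd by (simp add: cSUP_le_iff)
qed

lemma infdist_le_hausdorff_dist:
  assumes "A \<noteq> {}" "bounded A" "B \<noteq> {}" "bounded B"
  shows "a \<in> A \<Longrightarrow> infdist a B \<le> hausdorff_dist A B"
    and "b \<in> B \<Longrightarrow> infdist b A \<le> hausdorff_dist A B"
  using hausdorff_dist_le_iff[OF assms, THEN iffD1, OF order_refl] by auto

lemma hausdorff_dist_nonneg: "0 \<le> hausdorff_dist A B"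
proof (cases "A \<noteq> {} \<and> bounded A \<and> B \<noteq> {} \<and> bounded B")
  case True
  then obtain a where "a \<in> A" by blast
  then have "infdist a B \<le> hausdorff_dist A B"
    using True by (intro infdist_le_hausdorff_dist) auto
  then show ?thesis using infdist_nonneg[of a B] by linarith
next
  case False
  then have "hausdorff_dist A B = 0" unfolding hausdorff_dist_def by (rule if_not_P)
  then show ?thesis by simp
qed

lemma hausdorff_dist_commute: "hausdorff_dist A B = hausdorff_dist B A"
proof -
  have "(SUP a\<in>S. INF b\<in>T. norm (a - b)) = (SUP a\<in>S. INF b\<in>T. norm (b - a))"
    for S T :: "'a set"
    by (subst norm_minus_commute) (rule refl)
  then have "max (SUP a\<in>A. INF b\<in>B. norm (a - b)) (SUP b\<in>B. INF a\<in>A. norm (a - b)) =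
      max (SUP b\<in>B. INF a\<in>A. norm (b - a)) (SUP a\<in>A. INF b\<in>B. norm (b - a))"
    by (metis max.commute)
  moreover have "(A \<noteq> {} \<and> bounded A \<and> B \<noteq> {} \<and> bounded B) =
      (B \<noteq> {} \<and> bounded B \<and> A \<noteq> {} \<and> bounded A)"
    by blast
  ultimately show ?thesis
    unfolding hausdorff_dist_def by presburger
qed

lemma sym_bodiesD:
  assumes "K \<in> sym_bodies"
  shows "K \<noteq> {}" "bounded K" "closed K"
  using assms interior_subset[of K] by (auto simp: sym_bodies_def)

lemma infdist_triangle_via:
  assumes "B \<noteq> {}" "infdist a B \<le> r" "\<forall>b\<in>B. infdist b C \<le> s"
  shows "infdist a C \<le> r + s"
proof (rule field_le_epsilon)
  fix e :: real
  assume "0 < e"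
  then have "(INF b\<in>B. dist a b) < r + e"
    using assms(1,2) by (simp add: infdist_def)
  then obtain b where b: "b \<in> B" "dist a b < r + e"
    using assms(1) by (subst (asm) cINF_less_iff) auto
  have "infdist a C \<le> infdist b C + dist a b"
    by (rule infdist_triangle)
  then show "infdist a C \<le> r + s + e"
    using b assms(3) by fastforce
qed

lemma Metric_space_sym_bodies:
  "Metric_space (sym_bodies :: (real ^ 'n) set set) hausdorff_dist"
proof
  fix A B :: "(real ^ 'n) set"
  show "0 \<le> hausdorff_dist A B" by (rule hausdorff_dist_nonneg)
  show "hausdorff_dist A B = hausdorff_dist B A" by (rule hausdorff_dist_commute)
next
  fix A B :: "(real ^ 'n) set"
  assume "A \<in> sym_bodies" "B \<in> sym_bodies"
  note A = sym_bodiesD[OF this(1)] and B = sym_bodiesD[OF this(2)]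
  show "hausdorff_dist A B = 0 \<longleftrightarrow> A = B"
  proof
    assume "hausdorff_dist A B = 0"
    then have le: "\<forall>a\<in>A. infdist a B \<le> 0" "\<forall>b\<in>B. infdist b A \<le> 0"
      using hausdorff_dist_le_iff[OF A(1,2) B(1,2), of 0] by auto
    have "a \<in> B" if "a \<in> A" for a
    proof -
      have "infdist a B = 0" using le(1) that by (intro antisym infdist_nonneg) blast
      then show ?thesis using in_closed_iff_infdist_zero[OF B(3,1)] by blast
    qed
    moreover have "b \<in> A" if "b \<in> B" for b
    proof -
      have "infdist b A = 0" using le(2) that by (intro antisym infdist_nonneg) blast
      then show ?thesis using in_closed_iff_infdist_zero[OF A(3,1)] by blast
    qed
    ultimately show "A = B" by blast
  next
    assume "A = B"
    then have "hausdorff_dist A B \<le> 0"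
      using hausdorff_dist_le_iff[OF A(1,2) B(1,2), of 0] by simp
    then show "hausdorff_dist A B = 0"
      using hausdorff_dist_nonneg[of A B] by simp
  qed
next
  fix A B C :: "(real ^ 'n) set"
  assume "A \<in> sym_bodies" "B \<in> sym_bodies" "C \<in> sym_bodies"
  note A = sym_bodiesD[OF this(1)] and B = sym_bodiesD[OF this(2)] and C = sym_bodiesD[OF this(3)]
  note AB = infdist_le_hausdorff_dist[OF A(1,2) B(1,2)]
  note BC = infdist_le_hausdorff_dist[OF B(1,2) C(1,2)]
  show "hausdorff_dist A C \<le> hausdorff_dist A B + hausdorff_dist B C"
    unfolding hausdorff_dist_le_iff[OF A(1,2) C(1,2)]
  proof (intro conjI ballI)
    fix a assume "a \<in> A"
    then show "infdist a C \<le> hausdorff_dist A B + hausdorff_dist B C"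
      by (intro infdist_triangle_via[OF B(1)] AB(1) ballI BC(1))
  next
    fix c assume "c \<in> C"
    then have "infdist c A \<le> hausdorff_dist B C + hausdorff_dist A B"
      by (intro infdist_triangle_via[OF B(1)] BC(2) ballI AB(2))
    then show "infdist c A \<le> hausdorff_dist A B + hausdorff_dist B C" by linarith
  qed
qed

lemma unit_ball_in_sym_bodies:
  fixes N :: "real ^ 'n \<Rightarrow> real"
  assumes N: "is_norm N"
  shows "unit_ball N \<in> sym_bodies"
proof -
  have nn: "\<And>x. 0 \<le> N x" and z: "\<And>x. N x = 0 \<longleftrightarrow> x = 0"
    and sc: "\<And>c x. N (c *\<^sub>R x) = \<bar>c\<bar> * N x" and tri: "\<And>x y. N (x + y) \<le> N x + N y"
    using N unfolding is_norm_def by blast+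
  have N0: "N 0 = 0" by (simp add: z)
  have conv: "convex_on UNIV N"
  proof (rule convex_onI)
    fix t :: real and x y :: "real ^ 'n"
    assume "0 < t" "t < 1"
    then show "N ((1 - t) *\<^sub>R x + t *\<^sub>R y) \<le> (1 - t) * N x + t * N y"
      using tri[of "(1 - t) *\<^sub>R x" "t *\<^sub>R y"] by (simp add: sc)
  qed auto
  have cont: "continuous_on UNIV N"
    using convex_on_continuous[OF open_UNIV conv] .
  have "closed (unit_ball N)"
    unfolding unit_ball_def by (intro closed_Collect_le cont continuous_on_const)
  moreover have "bounded (unit_ball N)"
  proof -
    have ne: "sphere (0 :: real ^ 'n) 1 \<noteq> {}" by simp
    obtain u where u: "u \<in> sphere 0 1" "\<And>x. x \<in> sphere 0 1 \<Longrightarrow> N u \<le> N x"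
      using continuous_attains_inf[OF compact_sphere ne continuous_on_subset[OF cont subset_UNIV]]
      by blast
    have "u \<noteq> 0" using u(1) by auto
    then have pos: "0 < N u" using nn[of u] z[of u] by linarith
    have "norm x \<le> 1 / N u" if "x \<in> unit_ball N" for x
    proof (cases "x = 0")
      case False
      then have "N u \<le> N ((1 / norm x) *\<^sub>R x)" by (intro u(2)) simp
      also have "\<dots> = N x / norm x" by (simp add: sc)
      also have "\<dots> \<le> 1 / norm x"
        using that by (intro divide_right_mono) (auto simp: unit_ball_def)
      finally have "N u * norm x \<le> 1" using False by (simp add: pos_le_divide_eq)
      then show ?thesis using pos by (simp add: pos_le_divide_eq mult.commute)
    qed (use pos in simp)
    then show ?thesis unfolding bounded_iff by blast
  qed
  moreover have "convex (unit_ball N)"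
  proof (rule convexI)
    fix x y :: "real ^ 'n" and u v :: real
    assume *: "x \<in> unit_ball N" "y \<in> unit_ball N" "0 \<le> u" "0 \<le> v" "u + v = 1"
    have "N (u *\<^sub>R x + v *\<^sub>R y) \<le> u * N x + v * N y"
      using tri[of "u *\<^sub>R x" "v *\<^sub>R y"] * by (simp add: sc)
    also have "\<dots> \<le> 1"
      using * by (intro convex_bound_le) (auto simp: unit_ball_def)
    finally show "u *\<^sub>R x + v *\<^sub>R y \<in> unit_ball N" by (simp add: unit_ball_def)
  qed
  moreover have "\<forall>x\<in>unit_ball N. - x \<in> unit_ball N"
    by (simp add: unit_ball_def is_norm_minus[OF N])
  moreover have "0 \<in> interior (unit_ball N)"
  proof (rule interiorI)
    show "open {x. N x < 1}" by (intro open_Collect_less cont continuous_on_const)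
    show "0 \<in> {x. N x < 1}" by (simp add: N0)
    show "{x. N x < 1} \<subseteq> unit_ball N" by (auto simp: unit_ball_def)
  qed
  ultimately show ?thesis by (simp add: sym_bodies_def)
qed

lemma topspace_sym_body_topology: "topspace sym_body_topology = sym_bodies"
  by (simp add: sym_body_topology_def Metric_space.topspace_mtopology[OF Metric_space_sym_bodies])

lemma unit_ball_inj_on: "inj_on unit_ball {N :: real ^ 'n \<Rightarrow> real. is_norm N}"
proof (rule inj_onI)
  have le: "M x \<le> N x"
    if N: "is_norm N" and M: "is_norm M" and eq: "unit_ball N = unit_ball M"
    for M N :: "real ^ 'n \<Rightarrow> real" and x
  proof (cases "x = 0")
    case True
    then have "M x = 0" "N x = 0" using N M unfolding is_norm_def by blast+
    then show ?thesis by simp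
  next
    case False
    then have "N x \<noteq> 0" "0 \<le> N x" using N unfolding is_norm_def by blast+
    then have pos: "0 < N x" by simp
    have "N ((1 / N x) *\<^sub>R x) = \<bar>1 / N x\<bar> * N x" using N unfolding is_norm_def by blast
    then have "(1 / N x) *\<^sub>R x \<in> unit_ball N" using pos by (simp add: unit_ball_def)
    then have "M ((1 / N x) *\<^sub>R x) \<le> 1" using eq by (auto simp: unit_ball_def)
    moreover have "M ((1 / N x) *\<^sub>R x) = \<bar>1 / N x\<bar> * M x" using M unfolding is_norm_def by blast
    ultimately show ?thesis using pos by (simp add: field_simps)
  qed
  fix M N :: "real ^ 'n \<Rightarrow> real"
  assume "M \<in> {N. is_norm N}" "N \<in> {N. is_norm N}" "unit_ball M = unit_ball N"
  then have "M x = N x" for x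
    using le[of M N x] le[of N M x] by simp
  then show "M = N" by (rule ext)
qed

end

theory Submission
  imports Defs
begin

text \<open>
  Call vectors \<open>u\<^sub>1, \<dots>, u\<^sub>m\<close> splittable if there are \<open>d\<close> \<open>\<rat>\<close>-linear functionals
  \<open>f\<^sub>1, \<dots>, f\<^sub>d\<close> from \<open>\<real>\<^sup>d\<close> to \<open>\<real>\<close> such that every \<open>u\<^sub>i\<close> is mapped to 1 by one of them.
  Two observations prove the theorem.

  First, let every finite family of unit vectors of a norm be splittable, as long as it
  does not contain two equal or opposite vectors. Given finitely many points, take for the
  \<open>u\<^sub>i\<close> the directions of the odd distances between them, one from each pair
  \<open>u, - u\<close>. Colour \<open>x\<close> by the \<open>d\<close> parities of \<open>\<lfloor>f\<^sub>l x\<rfloor>\<close>. If \<open>x - y\<close> is an odd multiple of \<open>\<plusminus>u\<^sub>i\<close>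
  and \<open>f\<^sub>l u\<^sub>i = 1\<close>, then \<open>f\<^sub>l x - f\<^sub>l y\<close> is an odd integer, so that the \<open>l\<close>-th parities of \<open>x\<close> and \<open>y\<close>
  differ. Hence every finite subgraph has a proper colouring with \<open>2\<^sup>d\<close> colours, and by
  compactness so has the whole graph.

  Secondly, a norm with an unsplittable family is exceptional. Write \<open>u\<^sub>i = \<Sum>\<^sub>t A\<^sub>i\<^sub>t y\<^sub>t\<close> with a rational
  matrix \<open>A\<close> and vectors \<open>y\<^sub>t\<close> that are independent over \<open>\<rat>\<close>. There are only countably many
  matrices, and the vectors \<open>u\<^sub>i\<close> are at distance at least \<open>1 / n\<close> from each other and
  from each other's negatives, for some \<open>n\<close>. So it suffices that for fixed \<open>A\<close> and \<open>n\<close> the norms with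
  such a family are nowhere dense.

  Approximate a given norm by a polyhedral norm \<open>max\<^sub>p \<bar>b\<^sub>p \<bullet> x\<bar>\<close> whose facets have diameter below
  \<open>1 / n\<close>. A family as above has its members on facets that are different even up to sign, say, after
  changes of sign, \<open>b\<^sub>p\<^sub>(\<^sub>i\<^sub>) \<bullet> u\<^sub>i = 1\<close> for all \<open>i\<close>. If the tensors \<open>A\<^sub>i \<otimes> b\<^sub>p\<^sub>(\<^sub>i\<^sub>)\<close> were linearly
  independent, then each \<open>b\<^sub>p\<^sub>(\<^sub>i\<^sub>)\<close> could be replaced by a standard basis vector
  \<open>e\<^sub>j\<^sub>(\<^sub>i\<^sub>)\<close> without losing independence; the rows \<open>A\<^sub>i\<close> with equal \<open>j(i)\<close> would then be independent,
  and the family would be splittable. So there is a relation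
  \<open>\<Sum>\<^sub>i c\<^sub>i A\<^sub>i \<otimes> b\<^sub>p\<^sub>(\<^sub>i\<^sub>) = 0\<close> with \<open>c \<noteq> 0\<close>, and pairing it with \<open>y\<close> gives
  \<open>\<Sum>\<^sub>i c\<^sub>i = \<Sum>\<^sub>i c\<^sub>i (b\<^sub>p\<^sub>(\<^sub>i\<^sub>) \<bullet> u\<^sub>i) = 0\<close>. A slight generic rescaling of the functionals \<open>b\<^sub>p\<close> destroys
  this equation for each of the finitely many maps \<open>i \<mapsto> p(i)\<close>. It stays violated for
  all norms near the rescaled one, because for their unit vectors the values
  \<open>b\<^sub>p\<^sub>(\<^sub>i\<^sub>) \<bullet> u\<^sub>i\<close> change by little.

  The exchange is \<open>tensor_independent_exchange\<close>, the approximation is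
  \<open>polyhedral_approximation_small_caps\<close>, the rescaling is \<open>generic_weights\<close>; they are combined in
  \<open>unsplittable_robustly_unrealised_nearby\<close>. The colouring is \<open>odd_distance_finite_colouring\<close>.
\<close>


section \<open>Independent tensors and splitting\<close>

text \<open>
  By induction on the number of rows. The functionals dual to the old rows reproduce each
  coordinate on them; if they did so on the new row too, that row would be a combination
  of the old ones. So some coordinate minus its reproduction vanishes on the old rows
  but not on the new one, and a multiple of it corrects the value there.
\<close>

lemma solvable_of_independent_rows:
  fixes M :: "'i \<Rightarrow> 't \<Rightarrow> real"
  assumes "finite I" and T: "finite T"
    and "\<And>c. \<forall>t\<in>T. (\<Sum>i\<in>I. c i * M i t) = 0 \<Longrightarrow> \<forall>i\<in>I. c i = 0"
  shows "\<exists>\<phi>. \<forall>i\<in>I. (\<Sum>t\<in>T. \<phi> t * M i t) = r i"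
  using assms(1,3)
proof (induction I arbitrary: r rule: finite_induct)
  case (insert i0 I)
  have indep: "\<forall>i\<in>I. c i = 0" if "\<forall>t\<in>T. (\<Sum>i\<in>I. c i * M i t) = 0" for c
  proof -
    have "(\<Sum>i\<in>insert i0 I. (c(i0 := 0)) i * M i t) = (\<Sum>i\<in>I. c i * M i t)" for t
      using insert.hyps by (auto intro!: sum.cong)
    then have "\<forall>i\<in>insert i0 I. (c(i0 := 0)) i = 0"
      using that by (intro insert.prems) simp
    then show ?thesis using insert.hyps by (metis fun_upd_other insertCI)
  qed
  have solve: "\<exists>\<phi>. \<forall>i\<in>I. (\<Sum>t\<in>T. \<phi> t * M i t) = r i" for r
    by (rule insert.IH) (use indep in blast)
  have "\<exists>\<delta>. \<forall>i l. l \<in> I \<longrightarrow> (\<Sum>t\<in>T. \<delta> i t * M l t) = (if i = l then 1 else 0)"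
  proof -
    have "\<forall>i. \<exists>\<delta>. \<forall>l\<in>I. (\<Sum>t\<in>T. \<delta> t * M l t) = (if i = l then 1 else 0)"
      by (intro allI solve)
    then show ?thesis by metis
  qed
  then obtain \<delta> where \<delta>: "\<And>i l. l \<in> I \<Longrightarrow> (\<Sum>t\<in>T. \<delta> i t * M l t) = (if i = l then 1 else 0)"
    by blast
  define d where "d i = (\<Sum>t\<in>T. \<delta> i t * M i0 t)" for i
  have "\<exists>s\<in>T. (\<Sum>i\<in>I. M i s * d i) \<noteq> M i0 s"
  proof (rule ccontr)
    assume "\<not> ?thesis"
    then have eq: "(\<Sum>i\<in>I. M i t * d i) = M i0 t" if "t \<in> T" for t using that by blast
    define c where "c i = (if i = i0 then - 1 else d i)" for i
    have "\<forall>t\<in>T. (\<Sum>i\<in>insert i0 I. c i * M i t) = 0"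
    proof
      fix t assume "t \<in> T"
      have "(\<Sum>i\<in>I. c i * M i t) = (\<Sum>i\<in>I. M i t * d i)"
        using insert.hyps by (intro sum.cong) (auto simp: c_def)
      then show "(\<Sum>i\<in>insert i0 I. c i * M i t) = 0"
        using insert.hyps eq[OF \<open>t \<in> T\<close>] by (simp add: c_def)
    qed
    from insert.prems[OF this] show False by (simp add: c_def)
  qed
  then obtain s where s: "s \<in> T" "(\<Sum>i\<in>I. M i s * d i) \<noteq> M i0 s" by blast
  \<comment> \<open>The coordinate \<open>s\<close> minus its reproduction by the dual functionals.\<close>
  define \<xi> where "\<xi> t = (if t = s then 1 else 0) - (\<Sum>i\<in>I. M i s * \<delta> i t)" for t
  have \<xi>: "(\<Sum>t\<in>T. \<xi> t * M l t) = M l s - (\<Sum>i\<in>I. M i s * (\<Sum>t\<in>T. \<delta> i t * M l t))" for l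
  proof -
    have "(\<Sum>t\<in>T. \<xi> t * M l t) =
        (\<Sum>t\<in>T. (if t = s then M l t else 0)) - (\<Sum>t\<in>T. \<Sum>i\<in>I. M i s * (\<delta> i t * M l t))"
      by (auto simp: \<xi>_def left_diff_distrib sum_subtractf sum_distrib_right mult.assoc
          intro!: sum.cong arg_cong2[of _ _ _ _ "(-)"])
    also have "(\<Sum>t\<in>T. \<Sum>i\<in>I. M i s * (\<delta> i t * M l t)) = (\<Sum>i\<in>I. M i s * (\<Sum>t\<in>T. \<delta> i t * M l t))"
      by (subst sum.swap) (simp add: sum_distrib_left)
    finally show ?thesis using s T by simp
  qed
  have \<xi>0: "(\<Sum>t\<in>T. \<xi> t * M l t) = 0" if "l \<in> I" for l
  proof -
    have "(\<Sum>i\<in>I. M i s * (\<Sum>t\<in>T. \<delta> i t * M l t)) = (\<Sum>i\<in>I. if i = l then M i s else 0)"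
      using \<delta>[OF that] by (intro sum.cong) auto
    then show ?thesis using that insert.hyps by (simp add: \<xi>)
  qed
  have \<xi>1: "(\<Sum>t\<in>T. \<xi> t * M i0 t) \<noteq> 0"
    using s by (simp add: \<xi> d_def)
  obtain \<psi> where \<psi>: "\<forall>i\<in>I. (\<Sum>t\<in>T. \<psi> t * M i t) = r i" using solve by blast
  define \<alpha> where "\<alpha> = (r i0 - (\<Sum>t\<in>T. \<psi> t * M i0 t)) / (\<Sum>t\<in>T. \<xi> t * M i0 t)"
  have "(\<Sum>t\<in>T. (\<psi> t + \<alpha> * \<xi> t) * M i t) = (\<Sum>t\<in>T. \<psi> t * M i t) + \<alpha> * (\<Sum>t\<in>T. \<xi> t * M i t)" for i
    by (simp add: distrib_right sum.distrib sum_distrib_left mult.assoc)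
  then have "\<forall>i\<in>insert i0 I. (\<Sum>t\<in>T. (\<psi> t + \<alpha> * \<xi> t) * M i t) = r i"
    using \<psi> \<xi>0 \<xi>1 by (simp add: \<alpha>_def)
  then show ?case by (rule exI[of _ "\<lambda>t. \<psi> t + \<alpha> * \<xi> t"])
qed simp

text \<open>
  Linear independence of the tensors \<open>A\<^sub>i \<otimes> b\<^sub>i\<close> in \<open>\<real>\<^sup>T \<otimes> \<real>\<^sup>n\<close>, written out so that the index set
  \<open>T\<close> need not be a type.
\<close>

definition tensor_independent ::
    "'i set \<Rightarrow> 't set \<Rightarrow> ('i \<Rightarrow> 't \<Rightarrow> real) \<Rightarrow> ('i \<Rightarrow> real ^ 'n) \<Rightarrow> bool" where
  "tensor_independent I T A b \<longleftrightarrow>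
     (\<forall>c. (\<forall>t\<in>T. (\<Sum>i\<in>I. (c i * A i t) *\<^sub>R b i) = 0) \<longrightarrow> (\<forall>i\<in>I. c i = 0))"

text \<open>
  If \<open>A\<^sub>i\<^sub>0 \<otimes> e\<^sub>l\<close> lies in the span of the other tensors for every \<open>l\<close>, then so does
  the combination \<open>A\<^sub>i\<^sub>0 \<otimes> b\<^sub>i\<^sub>0\<close>.
\<close>

lemma tensor_independent_exchange:
  fixes b :: "'i \<Rightarrow> real ^ 'n"
  assumes I: "finite I" "i0 \<in> I" and ind: "tensor_independent I T A b"
  shows "\<exists>l. tensor_independent I T A (b(i0 := axis l 1))"
proof (rule ccontr)
  assume "\<not> ?thesis"
  then have "\<forall>l. \<exists>c. (\<forall>t\<in>T. (\<Sum>i\<in>I. (c i * A i t) *\<^sub>R (b(i0 := axis l 1)) i) = 0) \<and> (\<exists>i\<in>I. c i \<noteq> 0)"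
    unfolding tensor_independent_def by blast
  then obtain c where c0: "\<And>l t. t \<in> T \<Longrightarrow> (\<Sum>i\<in>I. (c l i * A i t) *\<^sub>R (b(i0 := axis l 1)) i) = 0"
    and c1: "\<And>l. \<exists>i\<in>I. c l i \<noteq> 0" by metis
  define J where "J = I - {i0}"
  have J: "finite J" "i0 \<notin> J" "I = insert i0 J" using I by (auto simp: J_def)
  have c: "(c l i0 * A i0 t) *\<^sub>R axis l 1 + (\<Sum>i\<in>J. (c l i * A i t) *\<^sub>R b i) = 0" if "t \<in> T" for l t
  proof -
    have "(\<Sum>i\<in>J. (c l i * A i t) *\<^sub>R (b(i0 := axis l 1)) i) = (\<Sum>i\<in>J. (c l i * A i t) *\<^sub>R b i)"
      using J by (intro sum.cong) auto
    then show ?thesis using c0[OF that, of l] J by simp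
  qed
  have nz: "c l i0 \<noteq> 0" for l
  proof
    assume z: "c l i0 = 0"
    then have "\<forall>t\<in>T. (\<Sum>i\<in>I. (c l i * A i t) *\<^sub>R b i) = 0"
      using c[of _ l] J by simp
    then show False using ind c1[of l] unfolding tensor_independent_def by blast
  qed
  \<comment> \<open>The relations for the single \<open>l\<close>, normalised at \<open>i0\<close> and added up with the coordinates
    of \<open>b i0\<close> as coefficients.\<close>
  define e where "e i = (if i = i0 then 1 else (\<Sum>l\<in>UNIV. b i0 $ l * c l i / c l i0))" for i
  have "(\<Sum>i\<in>I. (e i * A i t) *\<^sub>R b i) = 0" if t: "t \<in> T" for t
  proof -
    have ax: "A i0 t *\<^sub>R axis l 1 = - (\<Sum>i\<in>J. (c l i / c l i0 * A i t) *\<^sub>R b i)" for l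
    proof -
      have "(1 / c l i0) *\<^sub>R ((c l i0 * A i0 t) *\<^sub>R axis l 1 + (\<Sum>i\<in>J. (c l i * A i t) *\<^sub>R b i)) = 0"
        using c[OF t] by simp
      then have "A i0 t *\<^sub>R axis l 1 + (\<Sum>i\<in>J. (c l i / c l i0 * A i t) *\<^sub>R b i) = 0"
        using nz[of l] by (simp add: scaleR_add_right scaleR_sum_right)
      then show ?thesis by (simp add: eq_neg_iff_add_eq_0)
    qed
    have "A i0 t *\<^sub>R b i0 = (\<Sum>l\<in>UNIV. b i0 $ l *\<^sub>R (A i0 t *\<^sub>R axis l 1))"
      by (subst basis_expansion[symmetric, of "b i0"])
         (simp add: scaleR_sum_right scalar_mult_eq_scaleR mult.commute)
    also have "\<dots> = - (\<Sum>l\<in>UNIV. \<Sum>i\<in>J. (b i0 $ l * c l i / c l i0 * A i t) *\<^sub>R b i)"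
      by (simp add: ax scaleR_sum_right sum_negf mult.assoc)
    also have "\<dots> = - (\<Sum>i\<in>J. (e i * A i t) *\<^sub>R b i)"
      using J by (subst sum.swap) (auto simp: e_def scaleR_sum_left sum_distrib_right intro!: sum.cong)
    finally show ?thesis using J by (simp add: e_def)
  qed
  then have "e i0 = 0" using ind I unfolding tensor_independent_def by blast
  then show False by (simp add: e_def)
qed

text \<open>
  Once every \<open>b\<^sub>i\<close> is a standard basis vector \<open>e\<^sub>j\<^sub>(\<^sub>i\<^sub>)\<close>, a linear functional on the tensors
  with value 1 on all \<open>A\<^sub>i \<otimes> e\<^sub>j\<^sub>(\<^sub>i\<^sub>)\<close> is a family of functionals \<open>\<Phi>\<^sub>l\<close> on the rows with
  \<open>\<Phi>\<^sub>j\<^sub>(\<^sub>i\<^sub>) A\<^sub>i = 1\<close>.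
\<close>

lemma split_of_tensor_independent:
  fixes b :: "'i \<Rightarrow> real ^ 'n"
  assumes I: "finite I" and T: "finite T" and ind: "tensor_independent I T A b"
  shows "\<exists>(j :: 'i \<Rightarrow> 'n) \<Phi>. \<forall>i\<in>I. (\<Sum>t\<in>T. \<Phi> (j i) t * A i t) = 1"
proof -
  have "\<exists>(j :: 'i \<Rightarrow> 'n) b'. tensor_independent I T A b' \<and> (\<forall>i\<in>J. b' i = axis (j i) 1)"
    if "finite J" "J \<subseteq> I" for J
    using that
  proof (induction J rule: finite_induct)
    case empty
    then show ?case using ind by blast
  next
    case (insert i0 J)
    then obtain j :: "'i \<Rightarrow> 'n" and b' where *: "tensor_independent I T A b'" "\<forall>i\<in>J. b' i = axis (j i) 1"
      by auto
    obtain l where "tensor_independent I T A (b'(i0 := axis l 1))"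
      using tensor_independent_exchange[OF I _ *(1), of i0] insert.prems by auto
    moreover have "\<forall>i\<in>insert i0 J. (b'(i0 := axis l 1)) i = axis ((j(i0 := l)) i) 1"
      using *(2) by simp
    ultimately show ?case by blast
  qed
  then obtain j :: "'i \<Rightarrow> 'n" and b' where b': "tensor_independent I T A b'" "\<forall>i\<in>I. b' i = axis (j i) 1"
    using I by blast
  define M where "M = (\<lambda>i (t, l). A i t * b' i $ l)"
  have "\<exists>\<phi>. \<forall>i\<in>I. (\<Sum>s\<in>T \<times> UNIV. \<phi> s * M i s) = 1"
  proof (rule solvable_of_independent_rows[OF I])
    fix c assume c: "\<forall>s\<in>T \<times> (UNIV :: 'n set). (\<Sum>i\<in>I. c i * M i s) = 0"
    have "\<forall>t\<in>T. (\<Sum>i\<in>I. (c i * A i t) *\<^sub>R b' i) = 0"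
      using c by (auto simp: vec_eq_iff M_def mult.assoc)
    then show "\<forall>i\<in>I. c i = 0" using b'(1) unfolding tensor_independent_def by blast
  qed (use T in simp)
  then obtain \<phi> where \<phi>: "\<forall>i\<in>I. (\<Sum>s\<in>T \<times> UNIV. \<phi> s * M i s) = 1" by blast
  have "(\<Sum>t\<in>T. \<phi> (t, j i) * A i t) = 1" if "i \<in> I" for i
  proof -
    have "(\<Sum>s\<in>T \<times> UNIV. \<phi> s * M i s) = (\<Sum>t\<in>T. \<Sum>l\<in>UNIV. \<phi> (t, l) * (A i t * b' i $ l))"
      by (simp add: sum.cartesian_product M_def split_def)
    also have "\<dots> = (\<Sum>t\<in>T. \<phi> (t, j i) * A i t)"
    proof (rule sum.cong[OF refl])
      fix t
      have "(\<Sum>l\<in>UNIV. \<phi> (t, l) * (A i t * b' i $ l)) = (\<Sum>l\<in>UNIV. if l = j i then \<phi> (t, l) * A i t else 0)"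
        using b'(2) that by (intro sum.cong) (auto simp: axis_def)
      then show "(\<Sum>l\<in>UNIV. \<phi> (t, l) * (A i t * b' i $ l)) = \<phi> (t, j i) * A i t" by simp
    qed
    finally show ?thesis using \<phi> that by simp
  qed
  then show ?thesis by (intro exI[of _ j] exI[of _ "\<lambda>l t. \<phi> (t, l)"]) auto
qed


section \<open>Norms and the Hausdorff distance of their unit balls\<close>

lemma is_normD:
  assumes "is_norm N"
  shows "0 \<le> N x" "N x = 0 \<longleftrightarrow> x = 0" "N (c *\<^sub>R x) = \<bar>c\<bar> * N x" "N (x + y) \<le> N x + N y"
  using assms unfolding is_norm_def by blast+

lemma is_norm_diff_le:
  assumes "is_norm N"
  shows "N x - N y \<le> N (x - y)"
  using is_normD(4)[OF assms, of "x - y" y] by simp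

lemma is_norm_equivalent:
  fixes N :: "real ^ 'n \<Rightarrow> real"
  assumes N: "is_norm N"
  obtains C R where "C > 0" "R > 0" "\<And>x. N x \<le> C * norm x" "\<And>x. norm x \<le> R * N x"
proof -
  have K: "bounded (unit_ball N)" "0 \<in> interior (unit_ball N)"
    using unit_ball_in_sym_bodies[OF N] by (auto simp: sym_bodies_def)
  obtain R where R: "R > 0" "\<And>x. x \<in> unit_ball N \<Longrightarrow> norm x \<le> R"
    using K(1) bounded_pos by blast
  obtain r where r: "r > 0" "cball 0 r \<subseteq> unit_ball N"
    using K(2) mem_interior_cball by blast
  have "N x \<le> (1 / r) * norm x" for x
  proof (cases "x = 0")
    case False
    then have "(r / norm x) *\<^sub>R x \<in> unit_ball N" using r by (intro subsetD[OF r(2)]) simp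
    then have "r / norm x * N x \<le> 1" using r by (simp add: unit_ball_def is_normD(3)[OF N])
    then show ?thesis using False r by (simp add: field_simps)
  qed (use is_normD(2)[OF N, of 0] in simp)
  moreover have "norm x \<le> R * N x" for x
  proof (cases "x = 0")
    case False
    then have pos: "N x > 0" using is_normD(1,2)[OF N, of x] by linarith
    then have "(1 / N x) *\<^sub>R x \<in> unit_ball N" by (simp add: unit_ball_def is_normD(3)[OF N])
    from R(2)[OF this] show ?thesis using pos by (simp add: field_simps)
  qed (use is_normD(2)[OF N, of 0] in simp)
  ultimately show ?thesis using that[of "1 / r" R] r R by auto
qed

text \<open>
  The norm is the Minkowski gauge of the body. Its infimum is approached from above only, so
  every estimate is made with a slightly larger scaling factor.
\<close>

lemma norm_of_sym_body:
  fixes K :: "(real ^ 'n) set"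
  assumes K: "K \<in> sym_bodies"
  obtains N where "is_norm N" "unit_ball N = K"
proof -
  have cl: "closed K" and bd: "bounded K" and cv: "convex K" and sy: "\<And>x. x \<in> K \<Longrightarrow> - x \<in> K"
    and int0: "0 \<in> interior K"
    using K by (auto simp: sym_bodies_def)
  have K0: "0 \<in> K" using int0 interior_subset by blast
  define S where "S x = {t. 0 < t \<and> (1 / t) *\<^sub>R x \<in> K}" for x
  define N where "N x = Inf (S x)" for x
  obtain r where r: "r > 0" "cball 0 r \<subseteq> K"
    using int0 mem_interior_cball by blast
  obtain R where R: "R > 0" "\<And>x. x \<in> K \<Longrightarrow> norm x \<le> R"
    using bd bounded_pos by blast
  have ne: "S x \<noteq> {}" for x
  proof -
    have "norm x + 1 > 0" by (simp add: add_nonneg_pos)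
    then have "(1 / ((norm x + 1) / r)) *\<^sub>R x \<in> cball 0 r"
      using r by (simp add: pos_divide_le_eq algebra_simps)
    then have "(norm x + 1) / r \<in> S x" using r by (auto simp: S_def add_nonneg_pos)
    then show ?thesis by blast
  qed
  have bb: "bdd_below (S x)" for x by (rule bdd_belowI[of _ 0]) (auto simp: S_def)
  have nn: "0 \<le> N x" for x
    unfolding N_def by (rule cInf_greatest[OF ne]) (auto simp: S_def)
  have le: "N x \<le> s" if "s > 0" "(1 / s) *\<^sub>R x \<in> K" for x s
    unfolding N_def using that by (intro cInf_lower bb) (simp add: S_def)
  have mem: "(1 / s) *\<^sub>R x \<in> K" if lt: "N x < s" for x s
  proof -
    obtain t where t: "t \<in> S x" "t < s"
      using lt cInf_less_iff[OF ne bb] unfolding N_def by blast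
    then have "t > 0" "(1 / t) *\<^sub>R x \<in> K" by (auto simp: S_def)
    then have "(t / s) *\<^sub>R ((1 / t) *\<^sub>R x) + (1 - t / s) *\<^sub>R 0 \<in> K"
      using t K0 by (intro convexD[OF cv]) auto
    then show ?thesis using \<open>t > 0\<close> by simp
  qed
  have ball: "unit_ball N = K"
  proof (intro set_eqI iffI)
    fix x assume "x \<in> K"
    then show "x \<in> unit_ball N" using le[of 1 x] by (simp add: unit_ball_def)
  next
    fix x assume x: "x \<in> unit_ball N"
    have "(\<lambda>n. (1 / (1 + inverse (real (Suc n)))) *\<^sub>R x) \<longlonglongrightarrow> (1 / (1 + 0)) *\<^sub>R x"
      by (intro tendsto_intros LIMSEQ_inverse_real_of_nat) simp
    moreover have "(1 / (1 + inverse (real (Suc n)))) *\<^sub>R x \<in> K" for n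
      using x by (intro mem) (simp add: unit_ball_def add_pos_pos le_less_trans)
    ultimately show "x \<in> K" using closed_sequentially[OF cl] by fastforce
  qed
  have zero: "N x = 0 \<longleftrightarrow> x = 0" for x
  proof
    assume 0: "N x = 0"
    have "norm x \<le> 0 + e" if e: "e > 0" for e
    proof -
      have "norm ((1 / (e / R)) *\<^sub>R x) \<le> R" using 0 e R by (intro R(2) mem) simp
      then show ?thesis using e R by (simp add: field_simps)
    qed
    then have "norm x \<le> 0" by (rule field_le_epsilon)
    then show "x = 0" by simp
  next
    assume "x = 0"
    then have "N x \<le> 0 + e" if "e > 0" for e using le[of e x] K0 that by simp
    then have "N x \<le> 0" by (rule field_le_epsilon)
    then show "N x = 0" using nn[of x] by simp
  qed
  have scle: "N (c *\<^sub>R x) \<le> c * N x" if c: "c > 0" for c x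
  proof (rule field_le_epsilon)
    fix e :: real assume e: "e > 0"
    have "N (c *\<^sub>R x) \<le> c * (N x + e / c)"
    proof (rule le)
      show "c * (N x + e / c) > 0" using c e nn[of x] by (intro mult_pos_pos add_nonneg_pos) auto
      have "(1 / (N x + e / c)) *\<^sub>R x \<in> K" using c e by (intro mem) simp
      then show "(1 / (c * (N x + e / c))) *\<^sub>R c *\<^sub>R x \<in> K" using c by simp
    qed
    then show "N (c *\<^sub>R x) \<le> c * N x + e" using c by (simp add: distrib_left)
  qed
  have scpos: "N (c *\<^sub>R x) = c * N x" if c: "c > 0" for c x
  proof (rule antisym[OF scle[OF c]])
    have "N ((1 / c) *\<^sub>R (c *\<^sub>R x)) \<le> (1 / c) * N (c *\<^sub>R x)" using c by (intro scle) simp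
    then show "c * N x \<le> N (c *\<^sub>R x)" using c by (simp add: field_simps)
  qed
  have neg: "N (- x) = N x" for x
  proof -
    have "S (- x) = S x" using sy by (force simp: S_def)
    then show ?thesis by (simp add: N_def)
  qed
  have sc: "N (c *\<^sub>R x) = \<bar>c\<bar> * N x" for c x
  proof (cases c "0::real" rule: linorder_cases)
    case less
    then have "N (c *\<^sub>R x) = N ((- c) *\<^sub>R x)" using neg[of "c *\<^sub>R x"] by simp
    then show ?thesis using scpos[of "- c" x] less by simp
  qed (use scpos zero in auto)
  have tri: "N (x + y) \<le> N x + N y" for x y
  proof (rule field_le_epsilon)
    fix e :: real assume e: "e > 0"
    define s t where "s = N x + e / 2" and "t = N y + e / 2"
    have st: "s > 0" "t > 0" using e nn[of x] nn[of y] by (auto simp: s_def t_def)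
    have "(1 / s) *\<^sub>R x \<in> K" "(1 / t) *\<^sub>R y \<in> K" using e by (auto intro!: mem simp: s_def t_def)
    then have "(s / (s + t)) *\<^sub>R ((1 / s) *\<^sub>R x) + (t / (s + t)) *\<^sub>R ((1 / t) *\<^sub>R y) \<in> K"
      using st by (intro convexD[OF cv]) (auto simp: add_divide_distrib[symmetric])
    then have "(1 / (s + t)) *\<^sub>R (x + y) \<in> K" using st by (simp add: scaleR_add_right)
    then have "N (x + y) \<le> s + t" using st by (intro le) auto
    then show "N (x + y) \<le> N x + N y + e" by (simp add: s_def t_def)
  qed
  have "is_norm N" unfolding is_norm_def using nn zero sc tri by blast
  with ball that show ?thesis by blast
qed

text \<open>A hyperplane that separates \<open>p\<close> from the open unit ball, normalised at \<open>p\<close>.\<close>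

lemma supporting_functional:
  fixes N :: "real ^ 'n \<Rightarrow> real"
  assumes N: "is_norm N" and p: "N p = 1"
  obtains b where "b \<bullet> p = 1" "\<And>x. b \<bullet> x \<le> N x"
proof -
  note n = is_normD[OF N]
  obtain C R where C: "C > 0" "\<And>x. N x \<le> C * norm x" using is_norm_equivalent[OF N] by metis
  define S where "S = {x. N x < 1}"
  have "convex S"
  proof (rule convexI)
    fix x y and u v :: real
    assume *: "x \<in> S" "y \<in> S" "0 \<le> u" "0 \<le> v" "u + v = 1"
    have "N (u *\<^sub>R x + v *\<^sub>R y) \<le> u * N x + v * N y"
      using n(4)[of "u *\<^sub>R x" "v *\<^sub>R y"] * by (simp add: n(3))
    also have "\<dots> < 1" using * by (intro convex_bound_lt) (auto simp: S_def)
    finally show "u *\<^sub>R x + v *\<^sub>R y \<in> S" by (simp add: S_def)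
  qed
  moreover have "S \<noteq> {}" using n(2)[of 0] by (auto simp: S_def intro!: exI[of _ 0])
  moreover have "S \<inter> {p} = {}" using p by (simp add: S_def)
  ultimately obtain a \<beta> where a: "a \<noteq> 0" "\<And>x. x \<in> S \<Longrightarrow> a \<bullet> x \<le> \<beta>" "\<beta> \<le> a \<bullet> p"
    using separating_hyperplane_sets[of S "{p}"] by auto
  have bound: "a \<bullet> x \<le> (a \<bullet> p) * s" if s: "N x < s" for x s
  proof -
    have s0: "s > 0" using n(1)[of x] s by linarith
    then have "(1 / s) *\<^sub>R x \<in> S" using s by (simp add: S_def n(3))
    then have "a \<bullet> ((1 / s) *\<^sub>R x) \<le> a \<bullet> p" using a by fastforce
    then show ?thesis using s0 by (simp add: field_simps)
  qed
  have pos: "a \<bullet> p > 0"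
  proof -
    have "N a < C * norm a + 1" using C(2)[of a] by simp
    from bound[OF this] have "0 < (a \<bullet> p) * (C * norm a + 1)" using a(1) by (smt (verit) inner_gt_zero_iff)
    moreover have "C * norm a + 1 > 0" using C by (simp add: add_nonneg_pos)
    ultimately show ?thesis by (simp add: zero_less_mult_iff)
  qed
  have "a \<bullet> x \<le> (a \<bullet> p) * N x" for x
  proof (rule field_le_epsilon)
    fix e :: real assume e: "e > 0"
    have "a \<bullet> x \<le> (a \<bullet> p) * (N x + e / (a \<bullet> p))" using e pos by (intro bound) simp
    then show "a \<bullet> x \<le> (a \<bullet> p) * N x + e" using pos by (simp add: distrib_left)
  qed
  then have "((1 / (a \<bullet> p)) *\<^sub>R a) \<bullet> x \<le> N x" for x
    using pos by (simp add: field_simps)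
  moreover have "((1 / (a \<bullet> p)) *\<^sub>R a) \<bullet> p = 1" using pos by simp
  ultimately show ?thesis using that by blast
qed

lemma hausdorff_dist_unit_balls_le:
  fixes N M :: "real ^ 'n \<Rightarrow> real"
  assumes N: "is_norm N" and M: "is_norm M" and \<epsilon>: "0 \<le> \<epsilon>" "\<epsilon> \<le> 1/2" 
    and R: "\<And>x. norm x \<le> R * N x"
    and lower: "\<And>x. (1 - \<epsilon>) * N x \<le> M x" and upper: "\<And>x. M x \<le> (1 + \<epsilon>) * N x"
  shows "hausdorff_dist (unit_ball N) (unit_ball M) \<le> 2 * \<epsilon> * R"
proof -
  have R0: "0 \<le> R * N x" for x using R[of x] norm_ge_zero[of x] by linarith
  note bN = sym_bodiesD[OF unit_ball_in_sym_bodies[OF N]] and bM = sym_bodiesD[OF unit_ball_in_sym_bodies[OF M]]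
  have Rnn: "0 \<le> R"
  proof -
    have "N (axis undefined 1) > 0" using is_normD(1,2)[OF N, of "axis undefined 1"] by (simp add: less_le)
    then show ?thesis using R0[of "axis undefined 1"] by (simp add: zero_le_mult_iff)
  qed
  show ?thesis
    unfolding hausdorff_dist_le_iff[OF bN(1,2) bM(1,2)]
  proof (intro conjI ballI)
    fix a assume "a \<in> unit_ball N"
    then have a: "N a \<le> 1" by (simp add: unit_ball_def)
    have "M a \<le> (1 + \<epsilon>) * N a" by (rule upper)
    also have "\<dots> \<le> (1 + \<epsilon>) * 1" using a \<epsilon> by (intro mult_left_mono) auto
    finally have "M a \<le> 1 + \<epsilon>" by simp
    then have "M ((1 / (1 + \<epsilon>)) *\<^sub>R a) \<le> 1"
      using \<epsilon> by (simp add: is_normD(3)[OF M])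
    then have "infdist a (unit_ball M) \<le> dist a ((1 / (1 + \<epsilon>)) *\<^sub>R a)"
      by (intro infdist_le) (simp add: unit_ball_def)
    also have "dist a ((1 / (1 + \<epsilon>)) *\<^sub>R a) = norm ((1 - 1 / (1 + \<epsilon>)) *\<^sub>R a)"
      by (simp add: dist_norm scaleR_diff_left)
    also have "\<dots> = (\<epsilon> / (1 + \<epsilon>)) * norm a" using \<epsilon> by (simp add: field_simps)
    also have "\<dots> \<le> (2 * \<epsilon>) * R"
    proof (intro mult_mono)
      have "\<epsilon> / (1 + \<epsilon>) \<le> \<epsilon> / 1" using \<epsilon> by (intro divide_left_mono) auto
      then show "\<epsilon> / (1 + \<epsilon>) \<le> 2 * \<epsilon>" using \<epsilon> by simp
      show "norm a \<le> R" using R[of a] a Rnn mult_left_mono[OF a Rnn] by linarith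
    qed (use \<epsilon> in auto)
    finally show "infdist a (unit_ball M) \<le> 2 * \<epsilon> * R" .
  next
    fix b assume "b \<in> unit_ball M"
    then have b: "(1 - \<epsilon>) * N b \<le> 1" using lower[of b] by (simp add: unit_ball_def)
    then have "infdist b (unit_ball N) \<le> dist b ((1 - \<epsilon>) *\<^sub>R b)"
      using \<epsilon> by (intro infdist_le) (simp add: unit_ball_def is_normD(3)[OF N])
    also have "\<dots> = norm (\<epsilon> *\<^sub>R b)" by (simp add: dist_norm algebra_simps)
    also have "\<dots> = \<epsilon> * norm b" using \<epsilon> by simp
    also have "\<dots> \<le> \<epsilon> * (R * 2)"
    proof (intro mult_left_mono)
      have "(1/2) * N b \<le> (1 - \<epsilon>) * N b" using \<epsilon> is_normD(1)[OF N] by (intro mult_right_mono) auto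
      then have "N b \<le> 2" using b by linarith
      then show "norm b \<le> R * 2" using R[of b] mult_left_mono[OF _ Rnn, of "N b" 2] by linarith
    qed (use \<epsilon> in auto)
    finally show "infdist b (unit_ball N) \<le> 2 * \<epsilon> * R" by simp
  qed
qed

lemma infdist_less_obtain:
  assumes "infdist x S < e" "S \<noteq> {}"
  obtains y where "y \<in> S" "dist x y < e"
proof -
  have "(INF y\<in>S. dist x y) < e" using assms by (simp add: infdist_def)
  then show ?thesis using that assms(2) by (subst (asm) cINF_less_iff) auto
qed

text \<open>
  The upper bound for \<open>N x\<close> is clear, since \<open>x\<close> is close to a point of the unit ball of
  \<open>N\<close>. For the lower bound, the functional \<open>b\<close> that supports the ball of \<open>M\<close> at \<open>x\<close> is at most
  \<open>1 + \<epsilon> * norm b\<close> on the ball of \<open>N\<close>. As that ball contains a Euclidean ball of radius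
  \<open>1 / C\<close>, this bounds \<open>norm b\<close> in terms of \<open>N\<close> alone; applied to \<open>x / N x\<close>,
  it then shows that \<open>N x\<close> cannot be much smaller than 1.
\<close>

lemma hausdorff_near_imp_norm_near:
  fixes N :: "real ^ 'n \<Rightarrow> real"
  assumes N: "is_norm N" and \<delta>: "\<delta> > 0"
  obtains \<epsilon> where "\<epsilon> > 0"
    "\<And>M x. is_norm M \<Longrightarrow> hausdorff_dist (unit_ball N) (unit_ball M) < \<epsilon> \<Longrightarrow> M x = 1 \<Longrightarrow> \<bar>N x - 1\<bar> \<le> \<delta>"
proof -
  obtain C R where C: "C > 0" "\<And>x. N x \<le> C * norm x" using is_norm_equivalent[OF N] by metis
  define \<epsilon> where "\<epsilon> = min \<delta> 1 / (2 * C)"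
  have \<epsilon>: "\<epsilon> > 0" "C * \<epsilon> \<le> 1/2" "2 * C * \<epsilon> \<le> \<delta>" using C \<delta> by (auto simp: \<epsilon>_def)
  have "\<bar>N x - 1\<bar> \<le> \<delta>"
    if M: "is_norm M" and h: "hausdorff_dist (unit_ball N) (unit_ball M) < \<epsilon>" and x: "M x = 1" for M x
  proof -
    note bN = sym_bodiesD[OF unit_ball_in_sym_bodies[OF N]] and bM = sym_bodiesD[OF unit_ball_in_sym_bodies[OF M]]
    note hd = infdist_le_hausdorff_dist[OF bN(1,2) bM(1,2)]
    obtain y where y: "N y \<le> 1" "norm (x - y) < \<epsilon>"
    proof -
      have "infdist x (unit_ball N) < \<epsilon>" using hd(2)[of x] h x by (simp add: unit_ball_def)
      from infdist_less_obtain[OF this bN(1)] show ?thesis using that by (auto simp: unit_ball_def dist_norm)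
    qed
    have "N x \<le> 1 + C * \<epsilon>"
    proof -
      have "N x \<le> N y + N (x - y)" using is_norm_diff_le[OF N, of x y] by simp
      also have "\<dots> \<le> 1 + C * \<epsilon>" using y C(2)[of "x - y"] mult_left_mono[of "norm (x - y)" \<epsilon> C] C by linarith
      finally show ?thesis .
    qed
    moreover have "1 - 2 * C * \<epsilon> \<le> N x"
    proof (rule ccontr)
      assume lt: "\<not> 1 - 2 * C * \<epsilon> \<le> N x"
      obtain b where b: "b \<bullet> x = 1" "\<And>z. b \<bullet> z \<le> M z" using supporting_functional[OF M x] by blast
      have near: "b \<bullet> z \<le> 1 + norm b * \<epsilon>" if z: "N z \<le> 1" for z
      proof -
        have "infdist z (unit_ball M) < \<epsilon>" using hd(1)[of z] h z by (simp add: unit_ball_def)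
        then obtain w where w: "M w \<le> 1" "norm (z - w) < \<epsilon>"
          using infdist_less_obtain[OF _ bM(1)] by (auto simp: unit_ball_def dist_norm)
        have "b \<bullet> z = b \<bullet> w + b \<bullet> (z - w)" by (simp add: inner_diff_right)
        also have "\<dots> \<le> 1 + norm b * norm (z - w)"
          using b(2)[of w] w norm_cauchy_schwarz[of b "z - w"] by linarith
        also have "\<dots> \<le> 1 + norm b * \<epsilon>" using w by (intro add_left_mono mult_left_mono) auto
        finally show ?thesis .
      qed
      have b0: "b \<noteq> 0" using b by auto
      have "N ((1 / (C * norm b)) *\<^sub>R b) \<le> 1"
        using C(2)[of b] C(1) b0 by (simp add: is_normD(3)[OF N] field_simps)
      from near[OF this] have "norm b / C \<le> 1 + norm b * \<epsilon>"
        using b0 C(1) by (simp add: dot_square_norm power2_eq_square)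
      then have "norm b \<le> C + norm b * (C * \<epsilon>)" using C(1) by (simp add: field_simps)
      also have "\<dots> \<le> C + norm b * (1/2)" using \<epsilon> by (intro add_left_mono mult_left_mono) auto
      finally have nb: "norm b \<le> 2 * C" by simp
      have x0: "N x > 0" using b is_normD(1,2)[OF N, of x] by (metis inner_zero_right less_eq_real_def zero_neq_one)
      have "N ((1 / N x) *\<^sub>R x) \<le> 1" using x0 by (simp add: is_normD(3)[OF N])
      from near[OF this] have "1 / N x \<le> 1 + norm b * \<epsilon>" using b by simp
      also have "\<dots> \<le> 1 + 2 * C * \<epsilon>" using nb \<epsilon> by (intro add_left_mono mult_right_mono) auto
      finally have "1 \<le> (1 + 2 * C * \<epsilon>) * N x" using x0 by (simp add: field_simps)
      also have "\<dots> < (1 + 2 * C * \<epsilon>) * (1 - 2 * C * \<epsilon>)"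
        using lt C \<epsilon> by (intro mult_strict_left_mono) (auto simp: add_pos_pos)
      also have "\<dots> = 1 - (2 * C * \<epsilon>)\<^sup>2" by (simp add: algebra_simps power2_eq_square)
      also have "\<dots> \<le> 1" by simp
      finally show False by simp
    qed
    ultimately show ?thesis using \<epsilon> C mult_pos_pos[of C \<epsilon>] by (simp add: abs_le_iff)
  qed
  with \<epsilon> that show ?thesis by blast
qed


section \<open>Polyhedral approximation of norms\<close>

lemma is_norm_continuous:
  fixes N :: "real ^ 'n \<Rightarrow> real"
  assumes N: "is_norm N"
  shows "continuous_on UNIV N"
proof -
  obtain C R where C: "C > 0" "\<And>x. N x \<le> C * norm x" using is_norm_equivalent[OF N] by metis
  have "C-lipschitz_on UNIV N"
  proof (rule lipschitz_onI)
    fix x y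
    have "N x - N y \<le> C * dist x y" "N y - N x \<le> C * dist x y"
      using is_norm_diff_le[OF N, of x y] is_norm_diff_le[OF N, of y x] C(2)[of "x - y"] C(2)[of "y - x"]
      by (auto simp: dist_norm norm_minus_commute)
    then show "dist (N x) (N y) \<le> C * dist x y" by (simp add: dist_real_def abs_le_iff)
  qed (use C in simp)
  then show ?thesis by (rule lipschitz_on_continuous_on)
qed

lemma is_norm_sqrt_add_square:
  fixes N :: "real ^ 'n \<Rightarrow> real"
  assumes N: "is_norm N"
  shows "is_norm (\<lambda>x. sqrt ((N x)\<^sup>2 + (s * norm x)\<^sup>2))"
  unfolding is_norm_def
proof (intro conjI allI)
  fix x y :: "real ^ 'n" and c :: real
  show "0 \<le> sqrt ((N x)\<^sup>2 + (s * norm x)\<^sup>2)" by simp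
  show "sqrt ((N x)\<^sup>2 + (s * norm x)\<^sup>2) = 0 \<longleftrightarrow> x = 0"
    using is_normD(2)[OF N, of x] by (auto simp: sum_power2_eq_zero_iff)
  have "(N (c *\<^sub>R x))\<^sup>2 + (s * norm (c *\<^sub>R x))\<^sup>2 = c\<^sup>2 * ((N x)\<^sup>2 + (s * norm x)\<^sup>2)"
    by (simp add: is_normD(3)[OF N] algebra_simps)
  then show "sqrt ((N (c *\<^sub>R x))\<^sup>2 + (s * norm (c *\<^sub>R x))\<^sup>2) = \<bar>c\<bar> * sqrt ((N x)\<^sup>2 + (s * norm x)\<^sup>2)"
    by (simp add: real_sqrt_mult)
  have "(s * norm (x + y))\<^sup>2 \<le> (s * norm x + s * norm y)\<^sup>2"
    unfolding distrib_left[symmetric] power_mult_distrib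
    by (intro mult_left_mono power_mono norm_triangle_ineq) auto
  moreover have "(N (x + y))\<^sup>2 \<le> (N x + N y)\<^sup>2"
    using is_normD(1,4)[OF N] by (intro power_mono)
  ultimately have "sqrt ((N (x + y))\<^sup>2 + (s * norm (x + y))\<^sup>2) \<le>
      sqrt ((N x + N y)\<^sup>2 + (s * norm x + s * norm y)\<^sup>2)" by simp
  also have "\<dots> \<le> sqrt ((N x)\<^sup>2 + (s * norm x)\<^sup>2) + sqrt ((N y)\<^sup>2 + (s * norm y)\<^sup>2)"
    by (rule real_sqrt_sum_squares_triangle_ineq)
  finally show "sqrt ((N (x + y))\<^sup>2 + (s * norm (x + y))\<^sup>2) \<le>
      sqrt ((N x)\<^sup>2 + (s * norm x)\<^sup>2) + sqrt ((N y)\<^sup>2 + (s * norm y)\<^sup>2)" .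
qed

text \<open>
  The functionals support the unit ball at the points of a finite net of the unit sphere.
\<close>

lemma polyhedral_approximation:
  fixes N :: "real ^ 'n \<Rightarrow> real"
  assumes N: "is_norm N" and \<rho>: "\<rho> > 0"
  obtains q :: nat and b :: "nat \<Rightarrow> real ^ 'n" where
    "\<And>p x. p < q \<Longrightarrow> \<bar>b p \<bullet> x\<bar> \<le> N x" "\<And>x. \<exists>p<q. (1 - \<rho>) * N x \<le> \<bar>b p \<bullet> x\<bar>"
proof -
  obtain C R where C: "C > 0" "\<And>x. N x \<le> C * norm x" and R: "R > 0" "\<And>x. norm x \<le> R * N x"
    using is_norm_equivalent[OF N] by metis
  define S where "S = {x. N x = 1}"
  have unit: "(1 / N x) *\<^sub>R x \<in> S" if "x \<noteq> 0" for x
    using that is_normD(1,2)[OF N, of x] by (simp add: S_def is_normD(3)[OF N])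
  have "closed S"
    unfolding S_def by (intro closed_Collect_eq is_norm_continuous[OF N] continuous_on_const)
  moreover have "bounded S"
    unfolding bounded_iff
  proof (intro exI ballI)
    fix x assume "x \<in> S"
    then show "norm x \<le> R" using R(2)[of x] by (simp add: S_def)
  qed
  ultimately have "compact S" by (simp add: compact_eq_bounded_closed)
  then have "seq_compact S" by (rule compact_imp_seq_compact)
  from seq_compact_imp_totally_bounded[OF this, rule_format, of "\<rho> / C"]
  obtain P where P: "finite P" "P \<subseteq> S" "S \<subseteq> (\<Union>x\<in>P. ball x (\<rho> / C))" using \<rho> C by auto
  obtain q f where f: "P = f ` {i::nat. i < q}" using finite_imp_nat_seg_image_inj_on[OF P(1)] by blast
  have "\<exists>b. b \<bullet> f p = 1 \<and> (\<forall>x. b \<bullet> x \<le> N x)" if "p < q" for p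
  proof -
    have "N (f p) = 1" using that P(2) f by (auto simp: S_def)
    then show ?thesis using supporting_functional[OF N] by metis
  qed
  then obtain b where b: "\<And>p. p < q \<Longrightarrow> b p \<bullet> f p = 1" "\<And>p x. p < q \<Longrightarrow> b p \<bullet> x \<le> N x" by metis
  have upper: "\<bar>b p \<bullet> x\<bar> \<le> N x" if "p < q" for p x
    using b(2)[OF that, of x] b(2)[OF that, of "- x"] is_norm_minus[OF N, of x] by (simp add: abs_le_iff)
  have lower: "\<exists>p<q. (1 - \<rho>) * N x \<le> \<bar>b p \<bullet> x\<bar>" if x: "x \<noteq> 0" for x
  proof -
    define z where "z = (1 / N x) *\<^sub>R x"
    have pos: "N x > 0" using x is_normD(1,2)[OF N, of x] by linarith
    have "z \<in> S" using unit[OF x] by (simp add: z_def)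
    then obtain p where p: "p < q" "dist (f p) z < \<rho> / C" using P(3) f by auto
    have "N (f p - z) \<le> C * norm (f p - z)" by (rule C)
    also have "\<dots> \<le> \<rho>" using p C by (simp add: dist_norm field_simps)
    finally have "b p \<bullet> (f p - z) \<le> \<rho>" using b(2)[OF p(1), of "f p - z"] by linarith
    then have "1 - \<rho> \<le> b p \<bullet> z" using b(1)[OF p(1)] by (simp add: inner_diff_right)
    then have "(1 - \<rho>) * N x \<le> b p \<bullet> x" using pos by (simp add: z_def field_simps)
    then show ?thesis using p by force
  qed
  obtain x0 :: "real ^ 'n" where "x0 \<noteq> 0" using axis_eq_0_iff[of _ "1::real"] by (metis zero_neq_one)
  then have "q > 0" using lower by fastforce
  then have "\<exists>p<q. (1 - \<rho>) * N x \<le> \<bar>b p \<bullet> x\<bar>" for x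
    using lower[of x] is_normD(2)[OF N, of 0] by (cases "x = 0") auto
  with upper that show ?thesis by blast
qed

text \<open>
  The last conclusion says that facets are small: the set where a functional nearly
  attains the value 1, inside a slightly enlarged polyhedral ball, has small diameter.
  This would fail for a polyhedral approximation of a norm whose sphere contains
  segments, so a small multiple of the Euclidean norm is mixed in before. The square of
  the resulting norm \<open>N1\<close> is uniformly convex by the parallelogram law: if \<open>N1 x\<close> and
  \<open>N1 y\<close> are near 1 and the midpoint of \<open>x\<close> and \<open>y\<close> has norm near 1 too, then
  \<open>\<eta> * (norm (x - y))\<^sup>2\<close> is small. The midpoint has large norm because the functional of the
  facet is large there.
\<close>

lemma polyhedral_approximation_small_caps:
  fixes N :: "real ^ 'n \<Rightarrow> real"
  assumes N: "is_norm N" and \<epsilon>: "\<epsilon> > 0" and r: "r > 0"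
  obtains q :: nat and b :: "nat \<Rightarrow> real ^ 'n" and \<delta> where "\<delta> > 0" "\<delta> \<le> 1"
    "\<And>p x. p < q \<Longrightarrow> \<bar>b p \<bullet> x\<bar> \<le> (1 + \<epsilon>) * N x" "\<And>x. \<exists>p<q. (1 - \<epsilon>) * N x \<le> \<bar>b p \<bullet> x\<bar>"
    "\<And>p x y. p < q \<Longrightarrow> \<forall>p'<q. \<bar>b p' \<bullet> x\<bar> \<le> 1 + \<delta> \<Longrightarrow> \<forall>p'<q. \<bar>b p' \<bullet> y\<bar> \<le> 1 + \<delta> \<Longrightarrow>
       1 - \<delta> \<le> b p \<bullet> x \<Longrightarrow> 1 - \<delta> \<le> b p \<bullet> y \<Longrightarrow> norm (x - y) < r"
proof -
  obtain C R where R: "R > 0" "\<And>x. norm x \<le> R * N x"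
    using is_norm_equivalent[OF N] by metis
  define \<eta> where "\<eta> = \<epsilon> / R\<^sup>2"
  have \<eta>: "\<eta> > 0" "\<eta> * R\<^sup>2 = \<epsilon>" using \<epsilon> R by (auto simp: \<eta>_def)
  define N1 where "N1 x = sqrt ((N x)\<^sup>2 + (sqrt \<eta> * norm x)\<^sup>2)" for x
  have N1: "is_norm N1" unfolding N1_def by (rule is_norm_sqrt_add_square[OF N])
  have sq: "(N1 x)\<^sup>2 = (N x)\<^sup>2 + \<eta> * (norm x)\<^sup>2" for x
    using \<eta> by (simp add: N1_def power_mult_distrib)
  have NN1: "N x \<le> N1 x" for x
    unfolding N1_def by (rule real_le_rsqrt) simp
  have N1N: "N1 x \<le> (1 + \<epsilon>) * N x" for x
  proof (rule power2_le_imp_le)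
    have "(norm x)\<^sup>2 \<le> (R * N x)\<^sup>2" by (intro power_mono R) simp
    then have "\<eta> * (norm x)\<^sup>2 \<le> \<eta> * (R * N x)\<^sup>2" using \<eta> by (intro mult_left_mono) auto
    also have "\<dots> = \<epsilon> * (N x)\<^sup>2" using \<eta> by (simp add: power_mult_distrib mult.assoc[symmetric])
    finally have "(N1 x)\<^sup>2 \<le> (1 + \<epsilon>) * (N x)\<^sup>2" by (simp add: sq algebra_simps)
    also have "\<dots> \<le> (1 + \<epsilon>)\<^sup>2 * (N x)\<^sup>2" using \<epsilon> by (intro mult_right_mono) (auto simp: power2_eq_square)
    finally show "(N1 x)\<^sup>2 \<le> ((1 + \<epsilon>) * N x)\<^sup>2" by (simp add: power_mult_distrib)
    show "0 \<le> (1 + \<epsilon>) * N x" using \<epsilon> is_normD(1)[OF N] by simp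
  qed
  \<comment> \<open>The caps below satisfy \<open>\<eta> * (norm (x - y))\<^sup>2 \<le> 72 * \<delta>\<close>; any divisor above 72 does.\<close>
  define \<delta> where "\<delta> = min (min \<epsilon> (1 / 2)) (\<eta> * r\<^sup>2 / 80)"
  have \<delta>: "\<delta> > 0" "\<delta> \<le> \<epsilon>" "\<delta> \<le> 1 / 2" "80 * \<delta> \<le> \<eta> * r\<^sup>2"
    using \<epsilon> \<eta> r unfolding \<delta>_def by (auto simp: min_def)
  obtain q :: nat and b where up: "\<And>p x. p < q \<Longrightarrow> \<bar>b p \<bullet> x\<bar> \<le> N1 x"
    and low: "\<And>x. \<exists>p<q. (1 - \<delta>) * N1 x \<le> \<bar>b p \<bullet> x\<bar>"
    using polyhedral_approximation[OF N1 \<delta>(1)] by blast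
  have cap: "norm (x - y) < r"
    if p: "p < q" and x: "\<forall>p'<q. \<bar>b p' \<bullet> x\<bar> \<le> 1 + \<delta>" "1 - \<delta> \<le> b p \<bullet> x"
      and y: "\<forall>p'<q. \<bar>b p' \<bullet> y\<bar> \<le> 1 + \<delta>" "1 - \<delta> \<le> b p \<bullet> y" for p x y
  proof -
    define m where "m = (1 / 2) *\<^sub>R (x + y)"
    have N1le: "(N1 z)\<^sup>2 \<le> 1 + 16 * \<delta>" if z: "\<forall>p'<q. \<bar>b p' \<bullet> z\<bar> \<le> 1 + \<delta>" for z
    proof -
      have "(1 - \<delta>) * N1 z \<le> 1 + \<delta>" using low[of z] z by fastforce
      also have "1 + \<delta> \<le> (1 - \<delta>) * (1 + 4 * \<delta>)"
      proof -
        have "\<delta> * \<delta> \<le> (1 / 2) * \<delta>" using \<delta> by (intro mult_right_mono) auto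
        then show ?thesis by (simp add: algebra_simps)
      qed
      finally have "N1 z \<le> 1 + 4 * \<delta>" using \<delta> by simp
      then have "(N1 z)\<^sup>2 \<le> (1 + 4 * \<delta>)\<^sup>2" using is_normD(1)[OF N1] by (intro power_mono)
      also have "\<dots> \<le> 1 + 16 * \<delta>"
      proof -
        have "\<delta> * \<delta> \<le> (1 / 2) * \<delta>" using \<delta> by (intro mult_right_mono) auto
        then show ?thesis by (simp add: power2_eq_square algebra_simps)
      qed
      finally show ?thesis .
    qed
    have "1 - \<delta> \<le> b p \<bullet> m" using x(2) y(2) by (simp add: m_def inner_add_right)
    also have "\<dots> \<le> N1 m" using up[OF p, of m] by linarith
    finally have "(1 - \<delta>)\<^sup>2 \<le> (N1 m)\<^sup>2" using \<delta> by (intro power_mono) auto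
    moreover have "(1 - \<delta>)\<^sup>2 = 1 - 2 * \<delta> + \<delta>\<^sup>2" by (simp add: power2_diff)
    ultimately have 1: "1 - 2 * \<delta> \<le> (N1 m)\<^sup>2"
      using zero_le_power2[of \<delta>] by linarith
    have "N m \<le> (N x + N y) / 2"
      using is_normD(4)[OF N, of x y] unfolding m_def by (subst is_normD(3)[OF N]) simp
    then have "(N m)\<^sup>2 \<le> ((N x + N y) / 2)\<^sup>2" using is_normD(1)[OF N] by (intro power_mono)
    also have "\<dots> \<le> ((N x)\<^sup>2 + (N y)\<^sup>2) / 2"
      using zero_le_power2[of "N x - N y"] by (simp add: power2_eq_square field_simps)
    finally have 2: "(N m)\<^sup>2 \<le> ((N x)\<^sup>2 + (N y)\<^sup>2) / 2" .
    have "(norm m)\<^sup>2 = ((norm x)\<^sup>2 + (norm y)\<^sup>2) / 2 - (norm (x - y))\<^sup>2 / 4"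
      unfolding m_def power2_norm_eq_inner
      by (simp add: inner_add_left inner_add_right inner_diff_left inner_diff_right inner_commute[of y x] field_simps)
    then have 3: "\<eta> * (norm m)\<^sup>2 = (\<eta> * (norm x)\<^sup>2 + \<eta> * (norm y)\<^sup>2) / 2 - \<eta> * (norm (x - y))\<^sup>2 / 4"
      by (simp only:) (simp add: field_simps)
    have "d \<le> 72 * \<delta>"
      if "1 - 2 * \<delta> \<le> nm + em" "nm \<le> (nx + ny) / 2" "em = (ex + ey) / 2 - d / 4"
        "nx + ex \<le> 1 + 16 * \<delta>" "ny + ey \<le> 1 + 16 * \<delta>" for nm em nx ny ex ey d :: real
      using that by argo
    from this[OF 1[unfolded sq] 2 3 N1le[OF x(1), unfolded sq] N1le[OF y(1), unfolded sq]]
    have "\<eta> * (norm (x - y))\<^sup>2 \<le> 72 * \<delta>" .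
    also have "\<dots> < \<eta> * r\<^sup>2" using \<delta> by linarith
    finally have "(norm (x - y))\<^sup>2 < r\<^sup>2" using \<eta> by simp
    then show ?thesis using r by (simp add: power2_less_imp_less)
  qed
  have "\<bar>b p \<bullet> x\<bar> \<le> (1 + \<epsilon>) * N x" if "p < q" for p x
    using up[OF that, of x] N1N[of x] by linarith
  moreover have "\<exists>p<q. (1 - \<epsilon>) * N x \<le> \<bar>b p \<bullet> x\<bar>" for x
  proof -
    have "(1 - \<epsilon>) * N x \<le> (1 - \<delta>) * N x" using \<delta> is_normD(1)[OF N] by (intro mult_right_mono) auto
    also have "\<dots> \<le> (1 - \<delta>) * N1 x" using \<delta> NN1 by (intro mult_left_mono) auto
    finally show ?thesis using low[of x] by force
  qed
  moreover have "\<delta> \<le> 1" using \<delta> by simp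
  ultimately show ?thesis using that[of \<delta> q b] \<delta>(1) cap by blast
qed

text \<open>
  With the weights \<open>1 + \<sigma>\<^bsup>l+1\<^esup>\<close> each sum is a polynomial in \<open>\<sigma>\<close>. By injectivity of \<open>p\<close> its
  coefficient at \<open>p(i) + 1\<close> is \<open>c\<^sub>i\<close>, so it is not the zero polynomial, and only finitely many
  \<open>\<sigma>\<close> are excluded.
\<close>

lemma generic_weights:
  fixes F :: "((nat \<Rightarrow> nat) \<times> (nat \<Rightarrow> real)) set"
  assumes F: "finite F" and s: "s > 0"
    and nz: "\<And>p c. (p, c) \<in> F \<Longrightarrow> inj_on p {..<m} \<and> (\<exists>i<m. c i \<noteq> 0)"
  obtains w where "\<And>l. 1 \<le> w l" "\<And>l. w l \<le> 1 + s" "\<And>p c. (p, c) \<in> F \<Longrightarrow> (\<Sum>i<m. c i * w (p i)) \<noteq> 0"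
proof -
  define Q :: "(nat \<Rightarrow> nat) \<times> (nat \<Rightarrow> real) \<Rightarrow> real poly"
    where "Q = (\<lambda>(p, c). \<Sum>i<m. smult (c i) (1 + monom 1 (Suc (p i))))"
  have Q: "Q (p, c) \<noteq> 0" if pc: "(p, c) \<in> F" for p c
  proof -
    obtain i0 where i0: "i0 < m" "c i0 \<noteq> 0" using nz[OF pc] by blast
    have "coeff (Q (p, c)) (Suc (p i0)) = (\<Sum>i<m. c i * (if p i = p i0 then 1 else 0))"
      by (simp add: Q_def coeff_sum)
    also have "\<dots> = (\<Sum>i<m. if i = i0 then c i else 0)"
      using nz[OF pc] i0 by (intro sum.cong) (auto dest: inj_onD)
    finally have "coeff (Q (p, c)) (Suc (p i0)) \<noteq> 0" using i0 by simp
    then show ?thesis by auto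
  qed
  have "finite (\<Union>f\<in>F. {x. poly (Q f) x = 0})"
    using F Q by (auto intro: poly_roots_finite)
  moreover have "infinite {0 <..< min s 1}" using s by (simp add: infinite_Ioo)
  ultimately obtain \<sigma> where \<sigma>: "\<sigma> \<in> {0 <..< min s 1}" "\<sigma> \<notin> (\<Union>f\<in>F. {x. poly (Q f) x = 0})"
    by (meson finite_subset subsetI)
  define w where "w l = 1 + \<sigma> ^ Suc l" for l
  show ?thesis
  proof
    fix l
    show "1 \<le> w l" using \<sigma> by (simp add: w_def)
    have "\<sigma> ^ Suc l \<le> \<sigma> * 1" unfolding power_Suc using \<sigma> by (intro mult_left_mono power_le_one) auto
    also have "\<sigma> * 1 \<le> s" using \<sigma> by simp
    finally show "w l \<le> 1 + s" by (simp add: w_def)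
  next
    fix p c assume pc: "(p, c) \<in> F"
    have "poly (Q (p, c)) \<sigma> = (\<Sum>i<m. c i * w (p i))"
      by (simp add: Q_def poly_sum w_def poly_monom)
    then show "(\<Sum>i<m. c i * w (p i)) \<noteq> 0" using \<sigma> pc by auto
  qed
qed


section \<open>Norms realising an unsplittable matrix are nowhere dense\<close>

definition realises :: "nat \<Rightarrow> nat \<Rightarrow> (nat \<Rightarrow> nat \<Rightarrow> real) \<Rightarrow> real \<Rightarrow> (real ^ 'n \<Rightarrow> real) \<Rightarrow> bool" where
  "realises m k A r N \<longleftrightarrow>
     (\<exists>u y. (\<forall>i<m. u i = (\<Sum>t<k. A i t *\<^sub>R y t) \<and> N (u i) = 1) \<and>
        (\<forall>i<m. \<forall>j<m. i \<noteq> j \<longrightarrow> r \<le> norm (u i - u j) \<and> r \<le> norm (u i + u j)))"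

text \<open>
  The colouring functionals appear here through their values \<open>\<Phi> l t\<close> on the basis vectors
  \<open>y t\<close>; on \<open>u i\<close> the \<open>l\<close>-th one has the value \<open>\<Sum>t. \<Phi> l t * A i t\<close>.
\<close>

definition splits :: "nat \<Rightarrow> nat \<Rightarrow> (nat \<Rightarrow> nat \<Rightarrow> real) \<Rightarrow> (nat \<Rightarrow> 'n) \<Rightarrow> ('n \<Rightarrow> nat \<Rightarrow> real) \<Rightarrow> bool" where
  "splits m k A j \<Phi> \<longleftrightarrow> (\<forall>i<m. (\<Sum>t<k. \<Phi> (j i) t * A i t) = 1)"

lemma Max_image_lessThan_attained:
  fixes f :: "nat \<Rightarrow> real"
  assumes "q > 0"
  shows "\<exists>p<q. Max (f ` {..<q}) = f p"
proof -
  have "Max (f ` {..<q}) \<in> f ` {..<q}" using assms by (intro Max_in) auto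
  then obtain p where "Max (f ` {..<q}) = f p" "p \<in> {..<q}" by (rule imageE)
  then show ?thesis by (intro exI[of _ p]) simp
qed

lemma is_norm_weighted_Max:
  fixes b :: "nat \<Rightarrow> real ^ 'n"
  assumes N: "is_norm N" and w: "\<And>p. w p > 0" and c: "c > 0"
    and low: "\<And>x. \<exists>p<q. c * N x \<le> \<bar>b p \<bullet> x\<bar>"
  shows "is_norm (\<lambda>x. Max ((\<lambda>p. \<bar>b p \<bullet> x\<bar> / w p) ` {..<q}))"
proof -
  define M where "M x = Max ((\<lambda>p. \<bar>b p \<bullet> x\<bar> / w p) ` {..<q})" for x
  have q: "q > 0" using low[of 0] by auto
  have ge: "\<bar>b p \<bullet> x\<bar> / w p \<le> M x" if "p < q" for p x
    unfolding M_def using that by (intro Max_ge) auto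
  have at: "\<exists>p<q. M x = \<bar>b p \<bullet> x\<bar> / w p" for x
    unfolding M_def by (rule Max_image_lessThan_attained[OF q])
  have wn: "w p \<ge> 0" "w p \<noteq> 0" for p using w[of p] by auto
  have nn: "0 \<le> M x" for x
  proof -
    obtain p where "M x = \<bar>b p \<bullet> x\<bar> / w p" using at by blast
    then show ?thesis using wn by simp
  qed
  have le: "M x \<le> a" if "\<And>p. p < q \<Longrightarrow> \<bar>b p \<bullet> x\<bar> / w p \<le> a" for x a
  proof -
    obtain p where "p < q" "M x = \<bar>b p \<bullet> x\<bar> / w p" using at by blast
    then show ?thesis using that by simp
  qed
  have scle: "M (a *\<^sub>R x) = \<bar>a\<bar> * M x" for a x
  proof (rule antisym)
    show "M (a *\<^sub>R x) \<le> \<bar>a\<bar> * M x"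
    proof (rule le)
      fix p assume "p < q"
      then show "\<bar>b p \<bullet> a *\<^sub>R x\<bar> / w p \<le> \<bar>a\<bar> * M x"
        using mult_left_mono[OF ge[of p x], of "\<bar>a\<bar>"] by (simp add: abs_mult)
    qed
    obtain p where p: "p < q" "M x = \<bar>b p \<bullet> x\<bar> / w p" using at by blast
    have "\<bar>a\<bar> * M x = \<bar>b p \<bullet> a *\<^sub>R x\<bar> / w p" unfolding p(2) by (simp add: abs_mult)
    also have "\<dots> \<le> M (a *\<^sub>R x)" using p by (intro ge)
    finally show "\<bar>a\<bar> * M x \<le> M (a *\<^sub>R x)" .
  qed
  have zero: "M x = 0 \<longleftrightarrow> x = 0" for x
  proof
    assume 0: "M x = 0"
    obtain p where p: "p < q" "c * N x \<le> \<bar>b p \<bullet> x\<bar>" using low by blast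
    have "\<bar>b p \<bullet> x\<bar> / w p \<le> 0" using ge[OF p(1), of x] 0 by simp
    then have "\<bar>b p \<bullet> x\<bar> \<le> 0" using w[of p] by (simp add: divide_le_0_iff)
    then have "c * N x \<le> 0" using p by linarith
    then have "N x = 0" using c is_normD(1)[OF N, of x] by (simp add: mult_le_0_iff)
    then show "x = 0" using is_normD(2)[OF N] by blast
  next
    assume "x = 0"
    then show "M x = 0" using scle[of 0 x] by simp
  qed
  have tri: "M (x + y) \<le> M x + M y" for x y
  proof (rule le)
    fix p assume p: "p < q"
    have "\<bar>b p \<bullet> (x + y)\<bar> / w p \<le> \<bar>b p \<bullet> x\<bar> / w p + \<bar>b p \<bullet> y\<bar> / w p"
      using w[of p] by (simp add: inner_add_right add_divide_distrib[symmetric] divide_right_mono)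
    then show "\<bar>b p \<bullet> (x + y)\<bar> / w p \<le> M x + M y" using ge[OF p, of x] ge[OF p, of y] by linarith
  qed
  have "is_norm M" unfolding is_norm_def using nn zero scle tri by blast
  then show ?thesis unfolding M_def[abs_def] .
qed

lemma finite_uniform_lower_bound:
  fixes g :: "'a \<Rightarrow> real"
  assumes F: "finite F" and pos: "\<forall>f\<in>F. g f > 0"
  shows "\<exists>\<delta>>0. \<forall>f\<in>F. \<delta> < g f"
proof (intro exI conjI ballI)
  have m: "Min (insert 1 (g ` F)) > 0" using F pos by (subst Min_gr_iff) auto
  then show "Min (insert 1 (g ` F)) / 2 > 0" by simp
  fix f assume "f \<in> F"
  then have "Min (insert 1 (g ` F)) \<le> g f" using F by (intro Min_le) auto
  then show "Min (insert 1 (g ` F)) / 2 < g f" using m by linarith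
qed

text \<open>
  A vector with norm close to 1 lies near a facet of \<open>M\<close>. As facets are small and the members
  of a realisation are far apart up to sign, they belong to different facets. The relation
  between the tensors for these facets then forces a signed weighted sum of its coefficients to be
  at most \<open>\<delta>\<close> times the weighted sum of their absolute values, which the choice of weights
  excludes. The signs record on which of two opposite facets a vector lies.
\<close>

lemma unsplittable_robustly_unrealised_nearby:
  fixes N :: "real ^ 'n \<Rightarrow> real"
  assumes N: "is_norm N" and \<epsilon>: "\<epsilon> > 0" "\<epsilon> < 1" and r: "r > 0"
    and A: "\<And>j \<Phi>. \<not> splits m k A (j :: nat \<Rightarrow> 'n) \<Phi>"
  shows "\<exists>M \<delta>. is_norm M \<and> (\<forall>x. (1 - \<epsilon>) * N x \<le> M x) \<and> (\<forall>x. M x \<le> (1 + \<epsilon>) * N x) \<and> \<delta> > 0 \<and>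
    (\<forall>L :: real ^ 'n \<Rightarrow> real. (\<forall>x. L x = 1 \<longrightarrow> \<bar>M x - 1\<bar> \<le> \<delta>) \<longrightarrow> \<not> realises m k A r L)"
proof (rule polyhedral_approximation_small_caps[OF N half_gt_zero[OF \<epsilon>(1)] r])
  fix q :: nat and b :: "nat \<Rightarrow> real ^ 'n" and \<delta>0 :: real
  assume \<delta>0: "\<delta>0 > 0" "\<delta>0 \<le> 1"
    and up: "\<And>p x. p < q \<Longrightarrow> \<bar>b p \<bullet> x\<bar> \<le> (1 + \<epsilon> / 2) * N x"
    and low: "\<And>x. \<exists>p<q. (1 - \<epsilon> / 2) * N x \<le> \<bar>b p \<bullet> x\<bar>"
    and cap: "\<And>p x y. p < q \<Longrightarrow> \<forall>p'<q. \<bar>b p' \<bullet> x\<bar> \<le> 1 + \<delta>0 \<Longrightarrow> \<forall>p'<q. \<bar>b p' \<bullet> y\<bar> \<le> 1 + \<delta>0 \<Longrightarrow>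
       1 - \<delta>0 \<le> b p \<bullet> x \<Longrightarrow> 1 - \<delta>0 \<le> b p \<bullet> y \<Longrightarrow> norm (x - y) < r"
  have "\<exists>c. (\<forall>t<k. (\<Sum>i<m. (c i * A i t) *\<^sub>R b (p i)) = 0) \<and> (\<exists>i<m. c i \<noteq> 0)" for p
  proof -
    have "\<not> tensor_independent {..<m} {..<k} A (\<lambda>i. b (p i))"
    proof
      assume "tensor_independent {..<m} {..<k} A (\<lambda>i. b (p i))"
      from split_of_tensor_independent[OF _ _ this] obtain j :: "nat \<Rightarrow> 'n" and \<Phi>
        where "\<forall>i\<in>{..<m}. (\<Sum>t\<in>{..<k}. \<Phi> (j i) t * A i t) = 1" by auto
      then show False using A[of j \<Phi>] by (simp add: splits_def)
    qed
    then show ?thesis unfolding tensor_independent_def by auto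
  qed
  then obtain c where c: "\<And>p t. t < k \<Longrightarrow> (\<Sum>i<m. (c p i * A i t) *\<^sub>R b (p i)) = 0" "\<And>p. \<exists>i<m. c p i \<noteq> 0"
    by metis
  \<comment> \<open>The possible assignments of facets and signs to the vectors, and the resulting signed
    coefficients. Extensional functions make both sets finite.\<close>
  define G :: "((nat \<Rightarrow> nat) \<times> (nat \<Rightarrow> real)) set"
    where "G = {p \<in> {..<m} \<rightarrow>\<^sub>E {..<q}. inj_on p {..<m}} \<times> ({..<m} \<rightarrow>\<^sub>E {1, - 1})"
  define F where "F = (\<lambda>x. (fst x, \<lambda>i. c (fst x) i * snd x i)) ` G"
  have "finite ({..<m} \<rightarrow>\<^sub>E {..<q})" "finite ({..<m} \<rightarrow>\<^sub>E {1, - 1 :: real})"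
    by (intro finite_PiE; simp)+
  then have "finite G"
    unfolding G_def by (intro finite_cartesian_product) auto
  then have F: "finite F" by (simp add: F_def)
  define s0 where "s0 = min (\<epsilon> / 2) (\<delta>0 / 4)"
  have s0: "s0 > 0" "s0 \<le> \<epsilon> / 2" "s0 \<le> \<delta>0 / 4" using \<epsilon> \<delta>0 by (auto simp: s0_def)
  have "inj_on p {..<m} \<and> (\<exists>i<m. d i \<noteq> 0)" if pd: "(p, d) \<in> F" for p d
  proof -
    obtain x where x: "x \<in> G" "(p, d) = (fst x, \<lambda>i. c (fst x) i * snd x i)"
      using pd unfolding F_def by (rule imageE)
    define s where "s = snd x"
    have s: "inj_on p {..<m}" "s \<in> {..<m} \<rightarrow>\<^sub>E {1, - 1}" "d = (\<lambda>i. c p i * s i)"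
      using x by (simp_all add: G_def s_def mem_Times_iff)
    obtain i where i: "i < m" "c p i \<noteq> 0" using c(2) by blast
    have "s i \<in> {1, - 1}" using s(2) i(1) by (auto intro: PiE_mem)
    then have "d i \<noteq> 0" using i(2) unfolding s(3) by auto
    then show ?thesis using s(1) i(1) by blast
  qed
  from generic_weights[OF F s0(1) this] obtain w
    where w: "\<And>l. 1 \<le> w l" "\<And>l. w l \<le> 1 + s0"
      and wF: "\<And>p d. (p, d) \<in> F \<Longrightarrow> (\<Sum>i<m. d i * w (p i)) \<noteq> 0" by blast
  have w0: "w l > 0" for l using w(1)[of l] by linarith
  define M where "M x = Max ((\<lambda>p. \<bar>b p \<bullet> x\<bar> / w p) ` {..<q})" for x
  have M: "is_norm M"
    unfolding M_def using \<epsilon> by (intro is_norm_weighted_Max[OF N w0 _ low]) auto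
  have q: "q > 0" using low[of 0] by auto
  have ge: "\<bar>b p \<bullet> x\<bar> / w p \<le> M x" if "p < q" for p x
    unfolding M_def using that by (intro Max_ge) auto
  have at: "\<exists>p<q. M x = \<bar>b p \<bullet> x\<bar> / w p" for x
    unfolding M_def by (rule Max_image_lessThan_attained[OF q])
  have Mlow: "(1 - \<epsilon>) * N x \<le> M x" for x
  proof -
    obtain p where p: "p < q" "(1 - \<epsilon> / 2) * N x \<le> \<bar>b p \<bullet> x\<bar>" using low by blast
    have "(1 - \<epsilon>) * N x * w p \<le> (1 - \<epsilon>) * N x * (1 + \<epsilon> / 2)"
      using w(2)[of p] s0 \<epsilon> is_normD(1)[OF N] by (intro mult_left_mono) auto
    also have "\<dots> = ((1 - \<epsilon>) * (1 + \<epsilon> / 2)) * N x" by simp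
    also have "\<dots> \<le> (1 - \<epsilon> / 2) * N x"
      using \<epsilon> is_normD(1)[OF N] by (intro mult_right_mono) (auto simp: algebra_simps)
    also note p(2)
    finally have "(1 - \<epsilon>) * N x \<le> \<bar>b p \<bullet> x\<bar> / w p" using w0 by (simp add: pos_le_divide_eq)
    then show ?thesis using ge[OF p(1), of x] by linarith
  qed
  have Mup: "M x \<le> (1 + \<epsilon>) * N x" for x
  proof -
    obtain p where p: "p < q" "M x = \<bar>b p \<bullet> x\<bar> / w p" using at by blast
    have "M x \<le> \<bar>b p \<bullet> x\<bar> / 1" unfolding p(2) using w(1)[of p] by (intro divide_left_mono) auto
    also have "\<dots> \<le> (1 + \<epsilon> / 2) * N x" using up[OF p(1)] by simp
    also have "\<dots> \<le> (1 + \<epsilon>) * N x" using \<epsilon> is_normD(1)[OF N] by (intro mult_right_mono) auto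
    finally show ?thesis .
  qed
  define D where "D = (\<lambda>(p, d). \<Sum>i<m. \<bar>d i\<bar> * w (p i))"
  have D: "0 \<le> D f" for f 
    unfolding D_def split_def by (intro sum_nonneg mult_nonneg_nonneg less_imp_le[OF w0]) simp
  have "\<forall>f\<in>F. 0 < \<bar>\<Sum>i<m. snd f i * w (fst f i)\<bar> / (D f + 1)"
  proof
    fix f assume "f \<in> F"
    then show "0 < \<bar>\<Sum>i<m. snd f i * w (fst f i)\<bar> / (D f + 1)"
      using wF[of "fst f" "snd f"] D[of f] by (intro divide_pos_pos) auto
  qed
  from finite_uniform_lower_bound[OF F this] obtain \<delta>1 where \<delta>1: "\<delta>1 > 0"
    "\<forall>f\<in>F. \<delta>1 < \<bar>\<Sum>i<m. snd f i * w (fst f i)\<bar> / (D f + 1)" by blast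
  define \<delta> where "\<delta> = min \<delta>1 (\<delta>0 / 4)"
  have \<delta>: "\<delta> > 0" "\<delta> \<le> \<delta>1" "\<delta> \<le> \<delta>0 / 4" using \<delta>1(1) \<delta>0 by (auto simp: \<delta>_def)
  have "\<not> realises m k A r L" if L: "\<And>x. L x = 1 \<Longrightarrow> \<bar>M x - 1\<bar> \<le> \<delta>" for L :: "real ^ 'n \<Rightarrow> real"
  proof
    assume "realises m k A r L"
    then obtain u y where uy: "\<forall>i<m. u i = (\<Sum>t<k. A i t *\<^sub>R y t) \<and> L (u i) = 1"
      and dist: "\<forall>i<m. \<forall>j<m. i \<noteq> j \<longrightarrow> r \<le> norm (u i - u j) \<and> r \<le> norm (u i + u j)"
      unfolding realises_def by (elim exE conjE)
    then have u: "u i = (\<Sum>t<k. A i t *\<^sub>R y t)" "L (u i) = 1" if "i < m" for i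
      using uy that by blast+
    have Mu: "\<bar>M (u i) - 1\<bar> \<le> \<delta>" if "i < m" for i using L u(2)[OF that] by blast
    have "\<forall>i. \<exists>p. p < q \<and> M (u i) = \<bar>b p \<bullet> u i\<bar> / w p" using at by blast
    then obtain p0 where p0: "\<And>i. p0 i < q" "\<And>i. M (u i) = \<bar>b (p0 i) \<bullet> u i\<bar> / w (p0 i)" by metis
    \<comment> \<open>The vector \<open>s i *\<^sub>R u i\<close> lies near the facet on which \<open>b (p i)\<close> is maximal.\<close>
    define p where "p = restrict p0 {..<m}"
    define s :: "nat \<Rightarrow> real" where "s = restrict (\<lambda>i. if b (p0 i) \<bullet> u i \<ge> 0 then 1 else - 1) {..<m}"
    have s1: "s i = 1 \<or> s i = - 1" if "i < m" for i using that by (auto simp: s_def)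
    have bu: "b (p i) \<bullet> (s i *\<^sub>R u i) = w (p i) * M (u i)" if "i < m" for i
      using that p0(2)[of i] w0[of "p0 i"] by (auto simp: p_def s_def)
    have bound: "\<bar>b p' \<bullet> (s i *\<^sub>R u i)\<bar> \<le> 1 + \<delta>0" if i: "i < m" and p': "p' < q" for i p'
    proof -
      have "\<bar>b p' \<bullet> (s i *\<^sub>R u i)\<bar> = \<bar>b p' \<bullet> u i\<bar>" using s1[OF i] by auto
      also have "\<dots> \<le> M (u i) * w p'" using ge[OF p', of "u i"] w0[of p'] by (simp add: pos_divide_le_eq)
      also have "\<dots> \<le> (1 + \<delta>0 / 4) * (1 + \<delta>0 / 4)"
        using Mu[OF i] \<delta> w(2)[of p'] s0 w0[of p'] \<delta>0 by (intro mult_mono) auto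
      also have "\<dots> \<le> 1 + \<delta>0"
      proof -
        have "\<delta>0 * \<delta>0 \<le> 1 * \<delta>0" using \<delta>0 by (intro mult_right_mono) auto
        moreover have "(1 + \<delta>0 / 4) * (1 + \<delta>0 / 4) = 1 + \<delta>0 / 2 + \<delta>0 * \<delta>0 / 16"
          by (simp add: algebra_simps)
        ultimately show ?thesis using \<delta>0 by argo
      qed
      finally show ?thesis .
    qed
    have attained: "1 - \<delta>0 \<le> b (p i) \<bullet> (s i *\<^sub>R u i)" if i: "i < m" for i
    proof -
      have "1 - \<delta>0 \<le> M (u i)" using Mu[OF i] \<delta> \<delta>0 by (simp add: abs_le_iff)
      also have "\<dots> \<le> w (p i) * M (u i)"
        using mult_right_mono[OF w(1)[of "p i"] is_normD(1)[OF M, of "u i"]] by simp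
      finally show ?thesis using bu[OF i] by simp
    qed
    have inj: "inj_on p {..<m}"
    proof (rule inj_onI, rule ccontr)
      fix i j assume ij: "i \<in> {..<m}" "j \<in> {..<m}" "p i = p j" "i \<noteq> j"
      then have "norm (s i *\<^sub>R u i - s j *\<^sub>R u j) < r"
        using bound attained[of i] attained[of j] p0(1)[of j]
        by (intro cap[of "p j"]) (auto simp: p_def)
      moreover have "norm (s i *\<^sub>R u i - s j *\<^sub>R u j) \<in> {norm (u i - u j), norm (u i + u j)}"
      proof -
        have "norm (- u i - u j) = norm (u i + u j)"
          by (subst norm_minus_cancel[symmetric]) (simp add: add.commute)
        then show ?thesis using s1[of i] s1[of j] ij by (auto simp: norm_minus_commute[of "u j"])
      qed
      ultimately show False using dist ij by fastforce
    qed
    define d where "d = (\<lambda>i. c p i * s i)"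
    have "(p, s) \<in> G" using inj p0(1) by (auto simp: G_def p_def s_def)
    then have pd: "(p, d) \<in> F" unfolding F_def by (rule rev_image_eqI) (simp add: d_def)
    \<comment> \<open>The relation between the tensors, paired with \<open>y\<close>.\<close>
    have "(\<Sum>i<m. c p i * (b (p i) \<bullet> u i)) = (\<Sum>i<m. \<Sum>t<k. (c p i * A i t) * (b (p i) \<bullet> y t))"
      by (intro sum.cong) (auto simp: u(1) inner_sum_right sum_distrib_left mult.assoc)
    also have "\<dots> = (\<Sum>t<k. (\<Sum>i<m. (c p i * A i t) *\<^sub>R b (p i)) \<bullet> y t)"
      by (subst sum.swap) (simp add: inner_sum_left)
    also have "\<dots> = 0" using c(1) by simp
    finally have "(\<Sum>i<m. c p i * (b (p i) \<bullet> u i)) = 0" .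
    moreover have "c p i * (b (p i) \<bullet> u i) = d i * w (p i) * M (u i)" if "i < m" for i
      using bu[OF that] s1[OF that] by (auto simp: d_def)
    ultimately have zero: "(\<Sum>i<m. d i * w (p i) * M (u i)) = 0" by simp
    have "(\<Sum>i<m. d i * w (p i)) = (\<Sum>i<m. d i * w (p i) * (1 - M (u i)))"
      using zero by (simp add: right_diff_distrib sum_subtractf)
    also have "\<bar>\<dots>\<bar> \<le> (\<Sum>i<m. \<bar>d i\<bar> * w (p i) * \<delta>)"
    proof (rule order_trans[OF sum_abs], rule sum_mono)
      fix i assume "i \<in> {..<m}"
      then have "\<bar>1 - M (u i)\<bar> \<le> \<delta>" using Mu[of i] by (simp add: abs_minus_commute)
      then show "\<bar>d i * w (p i) * (1 - M (u i))\<bar> \<le> \<bar>d i\<bar> * w (p i) * \<delta>"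
        using w0[of "p i"] by (simp add: abs_mult mult_left_mono)
    qed
    also have "\<dots> = D (p, d) * \<delta>" by (simp add: D_def sum_distrib_right)
    also have "\<dots> \<le> (D (p, d) + 1) * \<delta>1" using D[of "(p, d)"] \<delta> by (intro mult_mono) auto
    also have "\<dots> < \<bar>\<Sum>i<m. d i * w (p i)\<bar>"
      using bspec[OF \<delta>1(2) pd] D[of "(p, d)"] by (simp add: pos_less_divide_eq mult.commute)
    finally show False by simp
  qed
  then show ?thesis using M Mlow Mup \<delta>(1) by (intro exI[of _ M] exI[of _ \<delta>] conjI allI impI) auto
qed

lemma nowhere_dense_in_subset:
  assumes "nowhere_dense_in X S" "T \<subseteq> S"
  shows "nowhere_dense_in X T"
  unfolding nowhere_dense_in_def
proof (intro conjI allI impI)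
  have "S \<subseteq> topspace X" using assms(1) unfolding nowhere_dense_in_def by (rule conjunct1)
  with assms(2) show "T \<subseteq> topspace X" by (rule subset_trans)
  fix U assume "openin X U \<and> U \<noteq> {}"
  then obtain V where "openin X V" "V \<noteq> {}" "V \<subseteq> U" "V \<inter> S = {}"
    using assms(1) unfolding nowhere_dense_in_def by (elim conjE allE[of _ U]) auto
  moreover from this assms(2) have "V \<inter> T = {}" by auto
  ultimately show "\<exists>V. openin X V \<and> V \<noteq> {} \<and> V \<subseteq> U \<and> V \<inter> T = {}"
    by (intro exI[of _ V]) simp
qed

lemma nowhere_dense_realising_unsplittable:
  assumes r: "r > 0" and A: "\<And>j \<Phi>. \<not> splits m k A (j :: nat \<Rightarrow> 'n) \<Phi>"
  shows "nowhere_dense_in sym_body_topology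
    {unit_ball N | N :: real ^ 'n \<Rightarrow> real. is_norm N \<and> realises m k A r N}" (is "nowhere_dense_in _ ?S")
  unfolding nowhere_dense_in_def
proof (intro conjI allI impI)
  interpret H: Metric_space "sym_bodies :: (real ^ 'n) set set" hausdorff_dist
    by (rule Metric_space_sym_bodies)
  show "?S \<subseteq> topspace sym_body_topology"
    unfolding topspace_sym_body_topology
  proof
    fix K assume "K \<in> ?S"
    then obtain N :: "real ^ 'n \<Rightarrow> real" where "is_norm N" "K = unit_ball N" by blast
    then show "K \<in> sym_bodies" using unit_ball_in_sym_bodies by simp
  qed
  fix U :: "(real ^ 'n) set set" assume U: "openin sym_body_topology U \<and> U \<noteq> {}"
  then obtain K where K: "K \<in> U" by blast
  have "openin H.mtopology U" using U by (simp add: sym_body_topology_def)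
  then have "U \<subseteq> sym_bodies" and "\<exists>\<rho>>0. H.mball K \<rho> \<subseteq> U"
    unfolding H.openin_mtopology using K by simp_all
  then obtain \<rho> where \<rho>: "\<rho> > 0" "H.mball K \<rho> \<subseteq> U" and Ks: "K \<in> sym_bodies"
    using K by blast
  obtain N where N: "is_norm N" "unit_ball N = K" using norm_of_sym_body[OF Ks] by metis
  obtain C R where R: "R > 0" "\<And>x. norm x \<le> R * N x" using is_norm_equivalent[OF N(1)] by metis
  define \<epsilon> where "\<epsilon> = min (1 / 2) (\<rho> / (4 * R))"
  have \<epsilon>: "\<epsilon> > 0" "\<epsilon> \<le> 1 / 2" "2 * \<epsilon> * R < \<rho>"
  proof -
    show "\<epsilon> > 0" "\<epsilon> \<le> 1 / 2" using \<rho> R by (auto simp: \<epsilon>_def)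
    have "2 * \<epsilon> * R \<le> 2 * (\<rho> / (4 * R)) * R" using R by (intro mult_right_mono mult_left_mono) (auto simp: \<epsilon>_def)
    also have "\<dots> < \<rho>" using R \<rho> by simp
    finally show "2 * \<epsilon> * R < \<rho>" .
  qed
  have "\<epsilon> < 1" using \<epsilon>(2) by simp
  from unsplittable_robustly_unrealised_nearby[OF N(1) \<epsilon>(1) this r A]
  obtain M \<delta> where M: "is_norm M" "\<forall>x. (1 - \<epsilon>) * N x \<le> M x" "\<forall>x. M x \<le> (1 + \<epsilon>) * N x" "\<delta> > 0"
    and far: "\<forall>L :: real ^ 'n \<Rightarrow> real. (\<forall>x. L x = 1 \<longrightarrow> \<bar>M x - 1\<bar> \<le> \<delta>) \<longrightarrow> \<not> realises m k A r L"
    by (elim exE conjE)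
  obtain \<epsilon>' where \<epsilon>': "\<epsilon>' > 0" "\<And>L x. is_norm L \<Longrightarrow>
      hausdorff_dist (unit_ball M) (unit_ball L) < \<epsilon>' \<Longrightarrow> L x = 1 \<Longrightarrow> \<bar>M x - 1\<bar> \<le> \<delta>"
    using hausdorff_near_imp_norm_near[OF M(1,4)] by blast
  have Ms: "unit_ball M \<in> sym_bodies" by (rule unit_ball_in_sym_bodies[OF M(1)])
  have "hausdorff_dist K (unit_ball M) \<le> 2 * \<epsilon> * R"
    unfolding N(2)[symmetric]
    using M(2,3) \<epsilon>(1) by (intro hausdorff_dist_unit_balls_le[OF N(1) M(1) _ \<epsilon>(2) R(2)]) auto
  also note \<epsilon>(3)
  finally have "hausdorff_dist K (unit_ball M) < \<rho>" .
  then have MK: "unit_ball M \<in> H.mball K \<rho>" using Ks Ms by simp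
  define V where "V = H.mball K \<rho> \<inter> H.mball (unit_ball M) \<epsilon>'"
  have "openin sym_body_topology V"
    unfolding V_def sym_body_topology_def by (intro openin_Int H.openin_mball)
  moreover have "V \<noteq> {}" using MK Ms \<epsilon>' by (auto simp: V_def)
  moreover have "V \<inter> ?S = {}"
  proof (rule ccontr)
    assume "V \<inter> ?S \<noteq> {}"
    then obtain L where L: "unit_ball L \<in> V" "is_norm L" "realises m k A r L" by blast
    then have "hausdorff_dist (unit_ball M) (unit_ball L) < \<epsilon>'" by (simp add: V_def)
    then have "\<forall>x. L x = 1 \<longrightarrow> \<bar>M x - 1\<bar> \<le> \<delta>" using \<epsilon>'(2)[OF L(2)] by blast
    then show False using far L(3) by blast
  qed
  ultimately show "\<exists>V. openin sym_body_topology V \<and> V \<noteq> {} \<and> V \<subseteq> U \<and> V \<inter> ?S = {}"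
    using \<rho>(2) by (intro exI[of _ V] conjI) (auto simp: V_def)
qed


section \<open>From splitting to colouring\<close>

text \<open>
  The theorem of de Bruijn and Erdos. In the compact product of the discrete colour sets, the
  colourings that respect a given edge form a closed set, and the assumption says
  that these sets have the finite intersection property.
\<close>

lemma finite_subgraphs_colourable_imp_colourable:
  fixes E :: "'a \<Rightarrow> 'a \<Rightarrow> bool"
  assumes fin: "\<And>V. finite V \<Longrightarrow> \<exists>c. proper_colouring V E k c"
  shows "\<exists>c. proper_colouring UNIV E k c"
proof -
  define X where "X = product_topology (\<lambda>_ :: 'a. discrete_topology {..<k}) UNIV"
  have top: "c \<in> topspace X \<longleftrightarrow> (\<forall>x. c x < k)" for c by (auto simp: X_def)
  have k: "k > 0" using fin[of "{undefined}"] by (auto simp: proper_colouring_def)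
  have "compact_space X"
    unfolding X_def compact_space_product_topology by (simp add: compact_space_discrete_topology)
  define C where "C = (\<lambda>(x, y). {c \<in> topspace X. c x \<noteq> c y})"
  have "closedin X (C e)" for e
  proof -
    obtain x y where e: "e = (x, y)" by fastforce
    have "openin X {c \<in> topspace X. c z \<in> {a}}" if "a < k" for z a
      unfolding X_def using that
      by (intro openin_continuous_map_preimage[OF continuous_map_product_projection]) auto
    then have "openin X (\<Union>a<k. {c \<in> topspace X. c x \<in> {a}} \<inter> {c \<in> topspace X. c y \<in> {a}})"
      by (intro openin_Union) auto
    then have "closedin X (topspace X - (\<Union>a<k. {c \<in> topspace X. c x \<in> {a}} \<inter> {c \<in> topspace X. c y \<in> {a}}))"
      by (intro closedin_diff closedin_topspace)
    moreover have "topspace X - (\<Union>a<k. {c \<in> topspace X. c x \<in> {a}} \<inter> {c \<in> topspace X. c y \<in> {a}}) = C e"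
      by (auto simp: C_def e top)
    ultimately show ?thesis by simp
  qed
  define \<U> where "\<U> = insert (topspace X) (C ` {(x, y). E x y})"
  have "\<Inter>\<U> \<noteq> {}"
  proof (rule \<open>compact_space X\<close>[unfolded compact_space_fip, rule_format], intro conjI ballI allI impI)
    fix D assume "D \<in> \<U>"
    then show "closedin X D" using \<open>\<And>e. closedin X (C e)\<close> by (auto simp: \<U>_def)
  next
    fix \<F> assume \<F>: "finite \<F> \<and> \<F> \<subseteq> \<U>"
    then have "finite (\<F> - {topspace X})" "\<F> - {topspace X} \<subseteq> C ` {(x, y). E x y}" by (auto simp: \<U>_def)
    from finite_subset_image[OF this] obtain P
      where P: "P \<subseteq> {(x, y). E x y}" "finite P" "\<F> - {topspace X} = C ` P" by blast
    define V where "V = fst ` P \<union> snd ` P"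
    obtain c where c: "proper_colouring V E k c" using fin[of V] P(2) by (auto simp: V_def)
    define c' where "c' x = (if x \<in> V then c x else 0)" for x
    have c't: "c' \<in> topspace X" using c k by (auto simp: top c'_def proper_colouring_def)
    have "c' \<in> C e" if "e \<in> P" for e
    proof -
      obtain x y where e: "e = (x, y)" by fastforce
      then have "x \<in> V" "y \<in> V" "E x y" using that P(1) by (force simp: V_def)+
      then show ?thesis using c c't by (auto simp: e C_def c'_def proper_colouring_def)
    qed
    then have "c' \<in> D" if "D \<in> \<F>" for D
    proof (cases "D = topspace X")
      case False
      then have "D \<in> C ` P" unfolding P(3)[symmetric] using that by simp
      with \<open>\<And>e. e \<in> P \<Longrightarrow> c' \<in> C e\<close> show ?thesis by auto
    qed (use c't in simp)
    then have "c' \<in> \<Inter>\<F>" by simp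
    then show "\<Inter>\<F> \<noteq> {}" by (metis empty_iff)
  qed
  then obtain c where "c \<in> \<Inter>\<U>" by (meson all_not_in_conv)
  then have c: "c \<in> D" if "D \<in> \<U>" for D using that by simp
  have "c x < k" for x using c[of "topspace X"] by (auto simp: \<U>_def top)
  moreover have "c x \<noteq> c y" if "E x y" for x y
  proof -
    have "C (x, y) \<in> \<U>" using that by (auto simp: \<U>_def)
    from c[OF this] show ?thesis by (simp add: C_def)
  qed
  ultimately show ?thesis unfolding proper_colouring_def by blast
qed

definition rational_linear :: "('a::real_vector \<Rightarrow> real) \<Rightarrow> bool" where
  "rational_linear f \<longleftrightarrow>
     (\<forall>x y. f (x + y) = f x + f y) \<and> (\<forall>q x. f (of_rat q *\<^sub>R x) = of_rat q * f x)"

text \<open>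
  The vectors \<open>y t\<close> form a basis of the rational span of \<open>U\<close>, so that a rational linear map may be
  prescribed on them.
\<close>

lemma rational_coordinates:
  fixes U :: "'a::real_vector set"
  assumes U: "finite U"
  shows "\<exists>A y (k :: nat). (\<forall>u\<in>U. u = (\<Sum>t<k. of_rat (A u t) *\<^sub>R y t)) \<and>
    (\<forall>\<phi>. \<exists>f. rational_linear f \<and> (\<forall>u\<in>U. f u = (\<Sum>t<k. \<phi> t * of_rat (A u t))))"
proof -
  interpret Q: vector_space_pair "\<lambda>(q::rat) (x::'a). of_rat q *\<^sub>R x" "\<lambda>(q::rat) (x::real). of_rat q * x"
    by unfold_locales (auto simp: algebra_simps of_rat_add of_rat_mult)
  obtain B where B: "B \<subseteq> U" "Q.vs1.independent B" "U \<subseteq> Q.vs1.span B"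
    by (rule Q.vs1.maximal_independent_subset)
  have fB: "finite B" using B U finite_subset by blast
  obtain y where y: "bij_betw y {0..<card B} B" using ex_bij_betw_nat_finite[OF fB] by blast
  define k where "k = card B"
  have yk: "bij_betw y {..<k} B" using y by (simp add: k_def atLeast0LessThan)
  have "\<exists>g. u = (\<Sum>t<k. of_rat (g t) *\<^sub>R y t)" if u: "u \<in> U" for u
  proof -
    obtain h where "u = (\<Sum>v\<in>B. of_rat (h v) *\<^sub>R v)"
      using u B(3) unfolding Q.vs1.span_finite[OF fB] by blast
    also have "\<dots> = (\<Sum>t<k. of_rat (h (y t)) *\<^sub>R y t)" by (rule sum.reindex_bij_betw[OF yk, symmetric])
    finally show ?thesis by (rule exI[of _ "\<lambda>t. h (y t)"])
  qed
  then obtain A where A: "\<And>u. u \<in> U \<Longrightarrow> u = (\<Sum>t<k. of_rat (A u t) *\<^sub>R y t)" by metis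
  have "\<exists>f. rational_linear f \<and> (\<forall>u\<in>U. f u = (\<Sum>t<k. \<phi> t * of_rat (A u t)))" for \<phi> :: "nat \<Rightarrow> real"
  proof -
    define f where "f = Q.construct B (\<lambda>v. \<phi> (inv_into {..<k} y v))"
    interpret f: Vector_Spaces.linear "\<lambda>(q::rat) (x::'a). of_rat q *\<^sub>R x" "\<lambda>(q::rat) (x::real). of_rat q * x" f
      unfolding f_def by (rule Q.linear_construct[OF B(2)])
    have fy: "f (y t) = \<phi> t" if "t < k" for t
    proof -
      have "y t \<in> B" using yk that by (auto simp: bij_betw_def)
      then have "f (y t) = \<phi> (inv_into {..<k} y (y t))" unfolding f_def by (rule Q.construct_basis[OF B(2)])
      then show ?thesis using yk that by (simp add: bij_betw_def)
    qed
    have "f u = (\<Sum>t<k. \<phi> t * of_rat (A u t))" if "u \<in> U" for u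
    proof -
      have "f u = f (\<Sum>t<k. of_rat (A u t) *\<^sub>R y t)" using A[OF that] by simp
      also have "\<dots> = (\<Sum>t<k. \<phi> t * of_rat (A u t))" by (simp add: f.sum f.scale fy mult.commute)
      finally show ?thesis .
    qed
    moreover have "rational_linear f" unfolding rational_linear_def using f.add f.scale by blast
    ultimately show ?thesis by blast
  qed
  with A show ?thesis by blast
qed

text \<open>
  Lists of lists make the set of rational matrices countable by its type. An index outside the
  lists yields some fixed rational number; it does not occur for the matrices of coordinates, whose
  \<open>length L\<close> rows have exactly \<open>k\<close> entries.
\<close>

definition rat_matrix :: "rat list list \<Rightarrow> nat \<Rightarrow> nat \<Rightarrow> real" where
  "rat_matrix L i t = of_rat (L ! i ! t)"

text \<open>
  The parities of \<open>\<lfloor>f\<^sub>l x\<rfloor>\<close> give the colour, where \<open>f\<^sub>l\<close> is the rational linear functional with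
  value \<open>\<Phi> l t\<close> on \<open>y t\<close>. Along an odd distance in direction \<open>\<plusminus>u\<^sub>i\<close> the functional
  with index \<open>j i\<close> changes by an odd integer.
\<close>

lemma odd_distance_finite_colouring:
  fixes N :: "real ^ 'n \<Rightarrow> real"
  assumes N: "is_norm N" and V: "finite V"
    and split: "\<forall>L k n. realises (length L) k (rat_matrix L) (1 / real (Suc n)) N \<longrightarrow>
      (\<exists>(j :: nat \<Rightarrow> 'n) \<Phi>. splits (length L) k (rat_matrix L) j \<Phi>)"
  shows "\<exists>c :: real ^ 'n \<Rightarrow> 'n \<Rightarrow> bool. \<forall>x\<in>V. \<forall>y\<in>V. odd_distance_adj N x y \<longrightarrow> c x \<noteq> c y"
proof -
  define U where "U = (\<lambda>(x, y). (1 / N (x - y)) *\<^sub>R (x - y)) ` {(x, y) \<in> V \<times> V. odd_distance_adj N x y}"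
  have "finite U" unfolding U_def
    by (intro finite_imageI finite_subset[OF _ finite_cartesian_product[OF V V]]) auto
  have unit: "N u = 1" if "u \<in> U" for u
  proof -
    obtain x y where xy: "odd_distance_adj N x y" "u = (1 / N (x - y)) *\<^sub>R (x - y)" using \<open>u \<in> U\<close> by (auto simp: U_def)
    then have "N (x - y) \<noteq> 0" by (auto simp: odd_distance_adj_def)
    then show ?thesis using xy is_normD(1)[OF N, of "x - y"] by (simp add: is_normD(3)[OF N])
  qed
  \<comment> \<open>One vector from each pair of opposite directions: the choice depends only on the set
    \<open>{u, - u}\<close>.\<close>
  define g where "g u = (SOME w. w \<in> {u, - u})" for u :: "real ^ 'n"
  have g: "g u = u \<or> g u = - u" for u
  proof -
    have "g u \<in> {u, - u}" unfolding g_def by (rule someI_ex) blast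
    then show ?thesis by blast
  qed
  have gm: "g (- u) = g u" for u by (simp add: g_def insert_commute)
  define W where "W = g ` U"
  have W: "finite W" using \<open>finite U\<close> by (simp add: W_def)
  have W1: "N w = 1" if "w \<in> W" for w
  proof -
    obtain u where u: "u \<in> U" "w = g u" using \<open>w \<in> W\<close> by (auto simp: W_def)
    then show ?thesis using unit[OF u(1)] g[of u] is_norm_minus[OF N, of u] by auto
  qed
  have gW: "g w = w" if "w \<in> W" for w
  proof -
    obtain u where u: "u \<in> U" "w = g u" using \<open>w \<in> W\<close> by (auto simp: W_def)
    then show ?thesis using g[of u] gm[of u] by auto
  qed
  have Wd: "w - w' \<noteq> 0 \<and> w + w' \<noteq> 0" if "w \<in> W" "w' \<in> W" "w \<noteq> w'" for w w'
  proof -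
    have "w \<noteq> - w'" using gW[OF that(1)] gW[OF that(2)] gm[of w'] that(3) by auto
    then show ?thesis using that(3) by (simp add: eq_neg_iff_add_eq_0)
  qed
  define P where "P = {(w, w') \<in> W \<times> W. w \<noteq> w'}"
  have P: "finite P" unfolding P_def by (rule finite_subset[OF _ finite_cartesian_product[OF W W]]) auto
  have "\<forall>f\<in>P. 0 < min (norm (fst f - snd f)) (norm (fst f + snd f))"
    using Wd by (simp add: P_def case_prod_beta mem_Times_iff)
  from finite_uniform_lower_bound[OF P this] obtain r where r: "r > 0"
    "\<forall>f\<in>P. r < min (norm (fst f - snd f)) (norm (fst f + snd f))" by blast
  obtain n where n: "1 / real (Suc n) < r"
    using reals_Archimedean[OF r(1)] by (auto simp: inverse_eq_divide)
  from rational_coordinates[OF W] obtain A y and k :: nat where A: "\<forall>u\<in>W. u = (\<Sum>t<k. of_rat (A u t) *\<^sub>R y t)"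
    and ext: "\<forall>\<phi>. \<exists>f. rational_linear f \<and> (\<forall>u\<in>W. f u = (\<Sum>t<k. \<phi> t * of_rat (A u t)))"
    by blast
  obtain ws where ws: "set ws = W" "distinct ws" using finite_distinct_list[OF W] by blast
  define L where "L = map (\<lambda>u. map (A u) [0..<k]) ws"
  have L: "length L = length ws" "\<And>i t. i < length ws \<Longrightarrow> t < k \<Longrightarrow> rat_matrix L i t = of_rat (A (ws ! i) t)"
    by (auto simp: L_def rat_matrix_def)
  have "realises (length L) k (rat_matrix L) (1 / real (Suc n)) N"
    unfolding realises_def
  proof (rule exI[of _ "\<lambda>i. ws ! i"], rule exI[of _ y], intro conjI allI impI)
    fix i assume "i < length L"
    then have i: "i < length ws" "ws ! i \<in> W" using L ws by auto
    show "ws ! i = (\<Sum>t<k. rat_matrix L i t *\<^sub>R y t)" using bspec[OF A i(2)] L(2)[OF i(1)] by simp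
    show "N (ws ! i) = 1" using W1 i by blast
    fix j assume "j < length L" "i \<noteq> j"
    then have "(ws ! i, ws ! j) \<in> P"
      using i L ws by (auto simp: P_def nth_eq_iff_index_eq)
    from bspec[OF r(2) this] n show "1 / real (Suc n) \<le> norm (ws ! i - ws ! j)" "1 / real (Suc n) \<le> norm (ws ! i + ws ! j)"
      by auto
  qed
  with split obtain j :: "nat \<Rightarrow> 'n" and \<Phi> where "splits (length L) k (rat_matrix L) j \<Phi>" by blast
  then have \<Phi>: "(\<Sum>t<k. \<Phi> (j i) t * of_rat (A (ws ! i) t)) = 1" if "i < length ws" for i
    using that L by (simp add: splits_def)
  have "\<forall>l. \<exists>f. rational_linear f \<and> (\<forall>u\<in>W. f u = (\<Sum>t<k. \<Phi> l t * of_rat (A u t)))"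
    using ext by blast
  from choice[OF this] obtain f :: "'n \<Rightarrow> real ^ 'n \<Rightarrow> real"
    where f: "\<forall>l. rational_linear (f l) \<and> (\<forall>u\<in>W. f l u = (\<Sum>t<k. \<Phi> l t * of_rat (A u t)))" ..
  have fadd: "f l (x + x') = f l x + f l x'" for l x x'
    using f unfolding rational_linear_def by blast
  have fscale: "f l (of_rat q *\<^sub>R x) = of_rat q * f l x" for l q x
    using f unfolding rational_linear_def by blast
  have fint: "f l (of_int z *\<^sub>R x) = of_int z * f l x" for l z x
    using fscale[of l "of_int z" x] by simp
  define c where "c x l = even \<lfloor>f l x\<rfloor>" for x l
  have "c x \<noteq> c x'" if xV: "x \<in> V" "x' \<in> V" and adj: "odd_distance_adj N x x'" for x x'
  proof -
    obtain z :: int where z: "odd z" "N (x - x') = of_int z" using adj by (auto simp: odd_distance_adj_def)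
    then have z0: "z \<noteq> 0" by auto
    define u where "u = (1 / N (x - x')) *\<^sub>R (x - x')"
    have uU: "u \<in> U" unfolding U_def u_def using xV adj by auto
    have xx: "x = x' + of_int z *\<^sub>R u" using z z0 by (simp add: u_def)
    obtain i where i: "i < length ws" "ws ! i = g u" using uU ws by (metis W_def imageI in_set_conv_nth)
    have "g u \<in> W" using uU by (simp add: W_def)
    then have "f (j i) (g u) = 1" using f \<Phi>[OF i(1)] i(2) by simp
    moreover have "f (j i) (- u) = - f (j i) u" using fint[of "j i" "- 1" u] by simp
    ultimately have "f (j i) u = 1 \<or> f (j i) u = - 1" using g[of u] by auto
    then have "f (j i) x = f (j i) x' + of_int z \<or> f (j i) x = f (j i) x' + of_int (- z)"
      unfolding xx fadd fint by auto
    then have "\<lfloor>f (j i) x\<rfloor> = \<lfloor>f (j i) x'\<rfloor> + z \<or> \<lfloor>f (j i) x\<rfloor> = \<lfloor>f (j i) x'\<rfloor> + (- z)"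
      using floor_add_int by metis
    then have "c x (j i) \<noteq> c x' (j i)" using z(1) by (auto simp: c_def)
    then show ?thesis by auto
  qed
  then show ?thesis by blast
qed

lemma odd_distance_chromatic_number_le:
  fixes N :: "real ^ 'n \<Rightarrow> real"
  assumes N: "is_norm N"
    and split: "\<forall>L k n. realises (length L) k (rat_matrix L) (1 / real (Suc n)) N \<longrightarrow>
      (\<exists>(j :: nat \<Rightarrow> 'n) \<Phi>. splits (length L) k (rat_matrix L) j \<Phi>)"
  shows "chromatic_number UNIV (odd_distance_adj N) \<le> enat (2 ^ CARD('n))"
  unfolding chromatic_number_le_iff
proof (rule finite_subgraphs_colourable_imp_colourable)
  fix V :: "(real ^ 'n) set" assume "finite V"
  from odd_distance_finite_colouring[OF N this split] obtain c :: "real ^ 'n \<Rightarrow> 'n \<Rightarrow> bool"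
    where c: "\<forall>x\<in>V. \<forall>y\<in>V. odd_distance_adj N x y \<longrightarrow> c x \<noteq> c y" by blast
  have "CARD('n \<Rightarrow> bool) = 2 ^ CARD('n)" by (simp add: card_fun)
  then obtain h :: "('n \<Rightarrow> bool) \<Rightarrow> nat" where h: "bij_betw h UNIV {0..<2 ^ CARD('n)}"
    using ex_bij_betw_finite_nat[of "UNIV :: ('n \<Rightarrow> bool) set"] by auto
  then have "inj h" "\<And>x. h x < 2 ^ CARD('n)" by (auto simp: bij_betw_def)
  then have "proper_colouring V (odd_distance_adj N) (2 ^ CARD('n)) (h \<circ> c)"
    using c by (auto simp: proper_colouring_def inj_eq)
  then show "\<exists>c. proper_colouring V (odd_distance_adj N) (2 ^ CARD('n)) c" by blast
qed


section \<open>Odd distance graphs of typical norms\<close>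

theorem theorem6p1:
  shows "all_norms_besides_meagre
    (\<lambda>N :: real ^ 'n \<Rightarrow> real. chromatic_number UNIV (odd_distance_adj N) \<le> enat (2 ^ CARD('n)))"
proof -
  define S :: "(real ^ 'n) set set" where "S = {unit_ball N | N. is_norm N \<and>
    \<not> chromatic_number UNIV (odd_distance_adj N) \<le> enat (2 ^ CARD('n))}"
  define I where "I = {(L, k, n :: nat). \<not> (\<exists>(j :: nat \<Rightarrow> 'n) \<Phi>. splits (length L) k (rat_matrix L) j \<Phi>)}"
  define R :: "rat list list \<times> nat \<times> nat \<Rightarrow> (real ^ 'n) set set" where
    "R = (\<lambda>(L, k, n). {unit_ball N | N. is_norm N \<and> realises (length L) k (rat_matrix L) (1 / real (Suc n)) N})"
  have "S \<subseteq> (\<Union>i\<in>I. R i)"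
  proof
    fix K assume "K \<in> S"
    then obtain N where N: "K = unit_ball N" "is_norm N"
      "\<not> chromatic_number UNIV (odd_distance_adj N) \<le> enat (2 ^ CARD('n))" by (auto simp: S_def)
    then obtain L k n where "realises (length L) k (rat_matrix L) (1 / real (Suc n)) N"
      "\<not> (\<exists>(j :: nat \<Rightarrow> 'n) \<Phi>. splits (length L) k (rat_matrix L) j \<Phi>)"
      using odd_distance_chromatic_number_le[OF N(2)] by blast
    then have "(L, k, n) \<in> I" "K \<in> R (L, k, n)" using N by (auto simp: I_def R_def)
    then show "K \<in> (\<Union>i\<in>I. R i)" by blast
  qed
  then have "S = \<Union>((\<lambda>i. S \<inter> R i) ` I)" by blast
  moreover have "countable ((\<lambda>i. S \<inter> R i) ` I)" by simp
  moreover have "nowhere_dense_in sym_body_topology (S \<inter> R i)" if i: "i \<in> I" for i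
  proof (rule nowhere_dense_in_subset[OF _ Int_lower2])
    obtain L k n where Lkn: "i = (L, k, n)" by (cases i)
    show "nowhere_dense_in sym_body_topology (R i)"
      unfolding R_def Lkn prod.case
    proof (rule nowhere_dense_realising_unsplittable)
      show "1 / real (Suc n) > 0" by simp
      show "\<not> splits (length L) k (rat_matrix L) j \<Phi>" for j :: "nat \<Rightarrow> 'n" and \<Phi>
        using i unfolding I_def Lkn by blast
    qed
  qed
  ultimately have "meagre_in sym_body_topology S"
    unfolding meagre_in_def by blast
  then show ?thesis by (simp add: all_norms_besides_meagre_def S_def)
qed

end
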